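(* Let $\phi(w)=aw+b$ with $a>0$ and $\mathrm{Re}(b)\geq 0$, regarded as a self-map of the open right half-plane $\mathbb{C}_+$. Then the composition operator $C_\phi$ is complex symmetric on $H^2(\mathbb{C}_+)$ if and only if $a=1$ or $\mathrm{Re}(b)=0$; that is, precisely when $C_\phi$ is normal.
   Context: $\mathbb{C}_+=\{w\in\mathbb{C}:\mathrm{Re}(w)>0\}$. The Hardy space $H^2(\mathbb{C}_+)$ is the Hilbert space of analytic functions $f$ on $\mathbb{C}_+$ for which $\|f\|_2^2=\sup_{0<x<\infty}\int_{-\infty}^{\infty}|f(x+iy)|^2\,dy$ is finite. For a holomorphic self-map $\phi$ of $\mathbb{C}_+$, the composition operator is $C_\phi f=f\circ\phi$; for $\phi(w)=aw+b$ with $a>0$ and $\mathrm{Re}(b)\ge 0$ it is a bounded operator on $H^2(\mathbb{C}_+)$. A conjugation on a Hilbert space $\mathcal{H}$ is a conjugate-linear operator $C:\mathcal{H}\to\mathcal{H}$ with $\langle Cf,Cg\rangle=\langle g,f\rangle$ for all $f,g\in\mathcal{H}$ and $C^2=I$. A bounded operator $T$ on a separable Hilbert space $\mathcal{H}$ is complex symmetric if there is a conjugation $C$ on $\mathcal{H}$ such that $CT=T^*C$. $T$ is normal if $TT^*=T^*T$. *)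

theory Defs
  imports "HOL-Complex_Analysis.Complex_Analysis"
begin

definition right_half_plane :: "complex set" where
  "right_half_plane = {w. Re w > 0}"

definition hardy_energy :: "(complex \<Rightarrow> complex) \<Rightarrow> ennreal" where
  "hardy_energy f =
     (SUP x\<in>{0<..}. \<integral>\<^sup>+ y. ennreal ((cmod (f (Complex x y)))\<^sup>2) \<partial>lborel)"

lemma line_measurable:
  assumes "f holomorphic_on right_half_plane" "x > 0"
  shows "(\<lambda>y. ennreal ((cmod (f (Complex x y)))\<^sup>2)) \<in> borel_measurable borel"
proof -
  have "continuous_on UNIV (\<lambda>y. f (Complex x y))"
  proof (rule continuous_on_compose2[OF holomorphic_on_imp_continuous_on[OF assms(1)]])
    show "continuous_on UNIV (\<lambda>y. Complex x y)"
      unfolding Complex_eq by (intro continuous_intros)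
  qed (use assms(2) in \<open>auto simp: right_half_plane_def\<close>)
  then show ?thesis
    by (intro measurable_compose[OF _ measurable_ennreal] borel_measurable_continuous_onI)
       (intro continuous_intros)
qed

lemma hardy_energy_add_finite:
  assumes "f holomorphic_on right_half_plane" "g holomorphic_on right_half_plane"
    and "hardy_energy f < \<infinity>" "hardy_energy g < \<infinity>"
  shows "hardy_energy (\<lambda>w. f w + g w) < \<infinity>"
proof -
  have "(\<integral>\<^sup>+ y. ennreal ((cmod (f (Complex x y) + g (Complex x y)))\<^sup>2) \<partial>lborel)
          \<le> 2 * hardy_energy f + 2 * hardy_energy g" if x: "x > 0" for x
  proof -
    have pw: "(cmod (u + v))\<^sup>2 \<le> 2 * (cmod u)\<^sup>2 + 2 * (cmod v)\<^sup>2" for u v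
    proof -
      have "(cmod (u + v))\<^sup>2 \<le> (cmod u + cmod v)\<^sup>2"
        by (intro power_mono norm_triangle_ineq) auto
      also have "\<dots> \<le> 2 * (cmod u)\<^sup>2 + 2 * (cmod v)\<^sup>2"
        using sum_squares_bound[of "cmod u" "cmod v"] by (simp add: power2_sum)
      finally show ?thesis .
    qed
    have "(\<integral>\<^sup>+ y. ennreal ((cmod (f (Complex x y) + g (Complex x y)))\<^sup>2) \<partial>lborel)
       \<le> (\<integral>\<^sup>+ y. 2 * ennreal ((cmod (f (Complex x y)))\<^sup>2)
             + 2 * ennreal ((cmod (g (Complex x y)))\<^sup>2) \<partial>lborel)"
    proof (rule nn_integral_mono)
      fix y
      let ?u = "f (Complex x y)" and ?v = "g (Complex x y)"
      have "ennreal ((cmod (?u + ?v))\<^sup>2) \<le> ennreal (2 * (cmod ?u)\<^sup>2 + 2 * (cmod ?v)\<^sup>2)"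
        by (intro ennreal_leI pw)
      also have "\<dots> = 2 * ennreal ((cmod ?u)\<^sup>2) + 2 * ennreal ((cmod ?v)\<^sup>2)"
        by (simp add: ennreal_plus ennreal_mult)
      finally show "ennreal ((cmod (?u + ?v))\<^sup>2)
          \<le> 2 * ennreal ((cmod ?u)\<^sup>2) + 2 * ennreal ((cmod ?v)\<^sup>2)" .
    qed
    also have "\<dots> = 2 * (\<integral>\<^sup>+ y. ennreal ((cmod (f (Complex x y)))\<^sup>2) \<partial>lborel)
             + 2 * (\<integral>\<^sup>+ y. ennreal ((cmod (g (Complex x y)))\<^sup>2) \<partial>lborel)"
      using line_measurable[OF assms(1) x] line_measurable[OF assms(2) x]
      by (simp add: nn_integral_add nn_integral_cmult)
    also have "\<dots> \<le> 2 * hardy_energy f + 2 * hardy_energy g"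
      unfolding hardy_energy_def using x by (intro add_mono mult_left_mono SUP_upper) auto
    finally show ?thesis .
  qed
  then have "hardy_energy (\<lambda>w. f w + g w) \<le> 2 * hardy_energy f + 2 * hardy_energy g"
    by (subst hardy_energy_def) (rule SUP_least, auto)
  also have "\<dots> < \<infinity>"
    using assms(3,4) by (simp add: ennreal_mult_less_top)
  finally show ?thesis .
qed

lemma hardy_energy_scale:
  assumes "f holomorphic_on right_half_plane"
  shows "hardy_energy (\<lambda>w. c * f w) = ennreal ((cmod c)\<^sup>2) * hardy_energy f"
proof -
  have "(\<integral>\<^sup>+ y. ennreal ((cmod (c * f (Complex x y)))\<^sup>2) \<partial>lborel)
      = ennreal ((cmod c)\<^sup>2) * (\<integral>\<^sup>+ y. ennreal ((cmod (f (Complex x y)))\<^sup>2) \<partial>lborel)"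
    if "x > 0" for x
    using line_measurable[OF assms that]
    by (simp add: norm_mult power_mult_distrib ennreal_mult nn_integral_cmult)
  then show ?thesis
    unfolding hardy_energy_def by (subst SUP_mult_left_ennreal) (auto intro!: SUP_cong)
qed

lemma hardy_energy_affine:
  assumes "f holomorphic_on right_half_plane" "a > 0" "Re b \<ge> 0"
  shows "hardy_energy (\<lambda>w. f (of_real a * w + b)) \<le> ennreal (1 / a) * hardy_energy f"
proof -
  have "(\<integral>\<^sup>+ y. ennreal ((cmod (f (of_real a * Complex x y + b)))\<^sup>2) \<partial>lborel)
          \<le> ennreal (1 / a) * hardy_energy f" if x: "x > 0" for x
  proof -
    have x': "a * x + Re b > 0"
      using x assms by (intro add_pos_nonneg) auto
    let ?h = "\<lambda>y. ennreal ((cmod (f (Complex (a * x + Re b) y)))\<^sup>2)"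
    have pt: "of_real a * Complex x y + b = Complex (a * x + Re b) (Im b + a * y)" for y
      by (simp add: complex_eq_iff)
    have "(\<integral>\<^sup>+ y. ?h y \<partial>lborel) = ennreal \<bar>a\<bar> * (\<integral>\<^sup>+ y. ?h (Im b + a * y) \<partial>lborel)"
      using assms by (intro nn_integral_real_affine line_measurable x') auto
    then have "ennreal (1 / a) * (\<integral>\<^sup>+ y. ?h y \<partial>lborel) = (\<integral>\<^sup>+ y. ?h (Im b + a * y) \<partial>lborel)"
      using assms by (simp add: mult.assoc[symmetric] ennreal_mult[symmetric])
    then have "(\<integral>\<^sup>+ y. ennreal ((cmod (f (of_real a * Complex x y + b)))\<^sup>2) \<partial>lborel)
        = ennreal (1 / a) * (\<integral>\<^sup>+ y. ?h y \<partial>lborel)"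
      by (simp add: pt)
    also have "\<dots> \<le> ennreal (1 / a) * hardy_energy f"
      unfolding hardy_energy_def using x' by (intro mult_left_mono SUP_upper) auto
    finally show ?thesis .
  qed
  then show ?thesis
    by (subst hardy_energy_def) (rule SUP_least, auto)
qed

text \<open>
  HOL functions are total, so an element of $H^2(\mathbb{C}_+)$ is represented by its extension
  by zero; equality in the type is then equality of functions on the half-plane.
\<close>

typedef hardy2 = "{f. f holomorphic_on right_half_plane \<and> hardy_energy f < \<infinity>
    \<and> (\<forall>w. w \<notin> right_half_plane \<longrightarrow> f w = 0)}"
  morphisms hardy_fun Abs_hardy2
  by (rule exI[of _ "\<lambda>_. 0"]) (auto simp: hardy_energy_def)

setup_lifting type_definition_hardy2

instantiation hardy2 :: ab_group_add
begin

lift_definition zero_hardy2 :: hardy2 is "\<lambda>_. 0"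
  by (auto simp: hardy_energy_def)

lift_definition plus_hardy2 :: "hardy2 \<Rightarrow> hardy2 \<Rightarrow> hardy2" is "\<lambda>f g w. f w + g w"
  using hardy_energy_add_finite by (auto intro: holomorphic_intros)

lift_definition uminus_hardy2 :: "hardy2 \<Rightarrow> hardy2" is "\<lambda>f w. - f w"
  by (auto simp: hardy_energy_def intro: holomorphic_intros)

definition minus_hardy2 :: "hardy2 \<Rightarrow> hardy2 \<Rightarrow> hardy2" where
  "minus_hardy2 f g = f + (- g)"

instance
  by standard (unfold minus_hardy2_def, (transfer, auto simp: fun_eq_iff)+)

end

lift_definition scaleC :: "complex \<Rightarrow> hardy2 \<Rightarrow> hardy2" is "\<lambda>c f w. c * f w"
  by (auto simp: hardy_energy_scale ennreal_mult_less_top intro: holomorphic_intros)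

interpretation hardy2: vector_space scaleC
  by standard (transfer, auto simp: fun_eq_iff algebra_simps)+

definition hardy_norm :: "hardy2 \<Rightarrow> real" where
  "hardy_norm f = sqrt (enn2real (hardy_energy (hardy_fun f)))"

text \<open>
  The inner product that induces the norm, linear in its first argument, recovered by
  polarization.
\<close>

definition hardy_inner :: "hardy2 \<Rightarrow> hardy2 \<Rightarrow> complex" where
  "hardy_inner f g =
     (\<Sum>k<4. \<i> ^ k * of_real ((hardy_norm (f + scaleC (\<i> ^ k) g))\<^sup>2)) / 4"

definition bounded_operator :: "(hardy2 \<Rightarrow> hardy2) \<Rightarrow> bool" where
  "bounded_operator T \<longleftrightarrow>
     Vector_Spaces.linear scaleC scaleC T \<and> (\<exists>K. \<forall>f. hardy_norm (T f) \<le> K * hardy_norm f)"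

text \<open>
  The description is well-defined when \<open>T\<close> is bounded and linear (Riesz representation), which the
  notions below include as a conjunct.
\<close>

definition hardy_adjoint :: "(hardy2 \<Rightarrow> hardy2) \<Rightarrow> hardy2 \<Rightarrow> hardy2" where
  "hardy_adjoint T g = (THE h. \<forall>f. hardy_inner (T f) g = hardy_inner f h)"

definition conjugation :: "(hardy2 \<Rightarrow> hardy2) \<Rightarrow> bool" where
  "conjugation C \<longleftrightarrow>
     (\<forall>f g. C (f + g) = C f + C g) \<and>
     (\<forall>c f. C (scaleC c f) = scaleC (cnj c) (C f)) \<and>
     (\<forall>f g. hardy_inner (C f) (C g) = hardy_inner g f) \<and>
     C \<circ> C = id"

definition complex_symmetric :: "(hardy2 \<Rightarrow> hardy2) \<Rightarrow> bool" where
  "complex_symmetric T \<longleftrightarrow>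
     bounded_operator T \<and> (\<exists>C. conjugation C \<and> C \<circ> T = hardy_adjoint T \<circ> C)"

definition normal_operator :: "(hardy2 \<Rightarrow> hardy2) \<Rightarrow> bool" where
  "normal_operator T \<longleftrightarrow>
     bounded_operator T \<and> T \<circ> hardy_adjoint T = hardy_adjoint T \<circ> T"

text \<open>
  This is meaningful for symbols \<open>\<phi>\<close> that map the half-plane to itself and for which composition
  preserves $H^2(\mathbb{C}_+)$; the lemmas below show that affine symbols qualify.
\<close>

definition composition_operator :: "(complex \<Rightarrow> complex) \<Rightarrow> hardy2 \<Rightarrow> hardy2" where
  "composition_operator \<phi> f =
     Abs_hardy2 (\<lambda>w. if w \<in> right_half_plane then hardy_fun f (\<phi> w) else 0)"

lemma hardy_energy_cong:
  assumes "\<And>w. w \<in> right_half_plane \<Longrightarrow> f w = g w"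
  shows "hardy_energy f = hardy_energy g"
  unfolding hardy_energy_def
  by (intro SUP_cong nn_integral_cong) (auto simp: assms right_half_plane_def)

lemma affine_maps_half_plane:
  assumes "a > 0" "Re b \<ge> 0" "w \<in> right_half_plane"
  shows "of_real a * w + b \<in> right_half_plane"
  using assms by (auto simp: right_half_plane_def intro!: add_pos_nonneg)

lemma hardy_fun_composition_affine:
  assumes "a > 0" "Re b \<ge> 0"
  shows "hardy_fun (composition_operator (\<lambda>w. of_real a * w + b) f) w
    = (if w \<in> right_half_plane then hardy_fun f (of_real a * w + b) else 0)"
proof -
  let ?g = "\<lambda>w. if w \<in> right_half_plane then hardy_fun f (of_real a * w + b) else 0"
  have f: "hardy_fun f holomorphic_on right_half_plane" "hardy_energy (hardy_fun f) < \<infinity>"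
    using hardy_fun[of f] by auto
  have "(hardy_fun f \<circ> (\<lambda>w. of_real a * w + b)) holomorphic_on right_half_plane"
    using affine_maps_half_plane[OF assms]
    by (intro holomorphic_on_compose_gen[OF _ f(1)] holomorphic_intros) auto
  then have "?g holomorphic_on right_half_plane"
    by (rule holomorphic_transform) auto
  moreover have "hardy_energy ?g = hardy_energy (\<lambda>w. hardy_fun f (of_real a * w + b))"
    by (rule hardy_energy_cong) auto
  then have "hardy_energy ?g \<le> ennreal (1 / a) * hardy_energy (hardy_fun f)"
    using hardy_energy_affine[OF f(1) assms] by simp
  then have "hardy_energy ?g < \<infinity>"
    using f(2) by (auto simp: ennreal_mult_less_top elim: le_less_trans)
  ultimately show ?thesis
    unfolding composition_operator_def by (subst Abs_hardy2_inverse) auto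
qed

lemma bounded_operator_composition_affine:
  assumes "a > 0" "Re b \<ge> 0"
  shows "bounded_operator (composition_operator (\<lambda>w. of_real a * w + b))"
    (is "bounded_operator ?T")
proof -
  have "Vector_Spaces.linear scaleC scaleC ?T"
  proof
    fix f g c
    show "?T (f + g) = ?T f + ?T g"
      by (rule iffD1[OF hardy_fun_inject], rule ext)
         (simp add: hardy_fun_composition_affine[OF assms] plus_hardy2.rep_eq)
    show "?T (scaleC c f) = scaleC c (?T f)"
      by (rule iffD1[OF hardy_fun_inject], rule ext)
         (simp add: hardy_fun_composition_affine[OF assms] scaleC.rep_eq)
  qed
  moreover have "hardy_norm (?T f) \<le> sqrt (1 / a) * hardy_norm f" for f
  proof -
    have f: "hardy_fun f holomorphic_on right_half_plane" "hardy_energy (hardy_fun f) < \<infinity>"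
      using hardy_fun[of f] by auto
    have "hardy_energy (hardy_fun (?T f)) = hardy_energy (\<lambda>w. hardy_fun f (of_real a * w + b))"
      by (rule hardy_energy_cong) (simp add: hardy_fun_composition_affine[OF assms])
    also have "\<dots> \<le> ennreal (1 / a) * hardy_energy (hardy_fun f)"
      by (rule hardy_energy_affine[OF f(1) assms])
    finally have "enn2real (hardy_energy (hardy_fun (?T f)))
        \<le> enn2real (ennreal (1 / a) * hardy_energy (hardy_fun f))"
      using f(2) by (intro enn2real_mono) (auto simp: ennreal_mult_less_top)
    also have "\<dots> = 1 / a * enn2real (hardy_energy (hardy_fun f))"
      using assms by (simp add: enn2real_mult)
    finally show ?thesis
      unfolding hardy_norm_def real_sqrt_mult[symmetric] by (rule real_sqrt_le_mono)
  qed
  ultimately show ?thesis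
    unfolding bounded_operator_def by blast
qed

end

theory Submission
  imports Defs "HOL-Probability.Sinc_Integral"
begin

text \<open>
  Write $\phi(w) = aw + b$. Everything rests on an explicit adjoint:
  $C_\phi^* = a^{-1} C_\psi$ with $\psi(w) = (w + \bar b)/a$
  (\<open>hardy_adjoint_composition_affine\<close>). Then $C_\phi C_\phi^*$ and $C_\phi^* C_\phi$ are, up to the
  factor $a^{-1}$, the translations by $2 \mathrm{Re}(b)/a$ and by $2 \mathrm{Re}(b)$, so normality
  means that these two numbers agree (\<open>normal_affine_composition_iff\<close>).

  In the normal cases a conjugation can be written down
  (\<open>complex_symmetric_affine_composition\<close>). For $a = 1$ it is $f \mapsto \overline{f(\bar w)}$. For
  $a \neq 1$ and $\mathrm{Re}(b) = 0$ the symbol is a dilation about the boundary point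
  $p = b/(1-a)$, and a conjugation has to reverse dilations about $p$; reflection in the unit
  circle around $p$ does so, giving $f \mapsto \overline{f(p + 1/\overline{(w-p)})}/(w-p)$.

  If $a \neq 1$ and $\mathrm{Re}(b) > 0$, then one of $\phi$ and $\psi$ is a contraction towards a
  point inside the half-plane. The reproducing kernel at that point is an eigenvector of the
  adjoint of composition with this contraction. A conjugation $C$ with
  $C C_\phi = C_\phi^* C$ would turn it into a nonzero function invariant under the contraction;
  iterating shows that such a function is constant, and $H^2$ contains no nonzero constant
  (\<open>not_complex_symmetric_affine_composition\<close>).

  Two analytic facts about $H^2$ are established for this. The norm is a
  supremum over vertical lines, and it has to be shown that it comes from an inner product. By
  shifting contours, $\int f(x+iy) \overline{g(s+iy)}\,dy$ depends only on $x+s$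
  (\<open>pairing_shift\<close>). Hence the energy of $f$ on the line $\mathrm{Re}(w) = x$ is a midpoint convex
  bounded function of $x$, so it decreases, and the supremum is the limit for $x \to 0$. The limit
  of the pairings then is the inner product (\<open>hardy_inner_tendsto\<close>), and the adjoint is a further
  consequence of the shift. The second fact is that $f \mapsto f(1/w)/w$ is an isometry
  (\<open>hardy_energy_inversion\<close>). Inversion does not map vertical lines to vertical lines; but it maps
  the imaginary axis to itself, so for functions that are continuous up to this axis the claim is the
  substitution $u = -1/y$, and the general case follows by approximation and Fatou's lemma.
\<close>

section \<open>Shifting vertical contours\<close>

text \<open>
  Translation invariance gives $\int (G(y+1) - G(y))\,dy = 0$. The integrand is
  $\int_0^1 G'(y+s)\,ds$, so by Fubini the same integral is $\int G'$. In this way no limits of $G$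
  at infinity enter.
\<close>

lemma integral_derivative_eq_0:
  fixes G G' :: "real \<Rightarrow> complex"
  assumes der: "\<And>y. (G has_vector_derivative G' y) (at y)"
    and cont: "continuous_on UNIV G'"
    and G: "integrable lborel G" and G': "integrable lborel G'"
  shows "(\<integral>y. G' y \<partial>lborel) = 0"
proof -
  define K where "K = (\<lambda>s y. indicator {0..1::real} s *\<^sub>R G' (y + s))"
  have ftc: "(\<integral>s. K s y \<partial>lborel) = G (y + 1) - G y" for y
  proof -
    have "((\<lambda>s. G (y + s)) has_vector_derivative G' (y + s)) (at s within {0..1})" for s
    proof -
      have "((\<lambda>s. y + s) has_vector_derivative 1) (at s within {0..1})"
        by (auto intro!: derivative_eq_intros)
      from vector_diff_chain_within[OF this has_vector_derivative_at_within[OF der]]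
      have "(G \<circ> (\<lambda>s. y + s) has_vector_derivative G' (y + s)) (at s within {0..1})"
        by simp
      then show ?thesis by (simp add: o_def)
    qed
    moreover have "continuous_on {0..1} (\<lambda>s. G' (y + s))"
      by (intro continuous_on_compose2[OF cont] continuous_intros) auto
    ultimately show ?thesis
      using integral_FTC_Icc[of 0 1 "\<lambda>s. G (y + s)" "\<lambda>s. G' (y + s)"] by (simp add: K_def)
  qed
  have shifted: "integrable lborel (\<lambda>y. G' (y + s))" "(\<integral>y. G' (y + s) \<partial>lborel) = (\<integral>y. G' y \<partial>lborel)" for s
    using lborel_integrable_real_affine[OF G', of 1 s] lborel_integral_real_affine[of 1 G' s]
    by (simp_all add: add.commute)
  have [measurable]: "G' \<in> borel_measurable borel"
    using cont by (rule borel_measurable_continuous_onI)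
  have norm_shifted: "(\<integral>y. norm (G' (y + s)) \<partial>lborel) = (\<integral>y. norm (G' y) \<partial>lborel)" for s
    using lborel_integral_real_affine[of 1 "\<lambda>y. norm (G' y)" s] by (simp add: add.commute)
  have "integrable (lborel \<Otimes>\<^sub>M lborel) (case_prod K)"
  proof (rule lborel_pair.Fubini_integrable)
    show "case_prod K \<in> borel_measurable (lborel \<Otimes>\<^sub>M lborel)"
      unfolding K_def by measurable
    show "integrable lborel (\<lambda>s. \<integral>y. norm (case_prod K (s, y)) \<partial>lborel)"
      by (simp add: K_def norm_shifted)
    show "AE s in lborel. integrable lborel (\<lambda>y. case_prod K (s, y))"
      by (simp add: K_def shifted)
  qed
  then have "(\<integral>y. (\<integral>s. K s y \<partial>lborel) \<partial>lborel) = (\<integral>s. (\<integral>y. K s y \<partial>lborel) \<partial>lborel)"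
    by (rule lborel_pair.Fubini_integral)
  also have "\<dots> = (\<integral>y. G' y \<partial>lborel)"
    by (simp add: K_def shifted)
  finally have "(\<integral>y. G' y \<partial>lborel) = (\<integral>y. G (y + 1) - G y \<partial>lborel)"
    by (simp add: ftc)
  also have "\<dots> = 0"
    using lborel_integrable_real_affine[OF G, of 1 1] lborel_integral_real_affine[of 1 G 1] G
    by (simp add: add.commute)
  finally show ?thesis .
qed

text \<open>
  Cauchy's theorem for an infinite strip, with decay at infinity replaced by a uniform $L^1$ bound
  on the vertical lines. If $P$ is a primitive of $F$, then the difference
  $G(y) = P(x_2+iy) - P(x_1+iy)$ is integrable, since it is an integral of $F$ over a horizontal
  segment, and $G'$ is, up to the factor $i$, the difference of the two integrands.
\<close>

lemma line_integral_shift: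
  assumes hol: "F holomorphic_on {z. \<alpha> < Re z \<and> Re z < \<beta>}"
    and x: "\<alpha> < x\<^sub>1" "x\<^sub>1 \<le> x\<^sub>2" "x\<^sub>2 < \<beta>"
    and bound: "\<And>x. x \<in> {x\<^sub>1..x\<^sub>2} \<Longrightarrow> (\<integral>\<^sup>+y. ennreal (cmod (F (Complex x y))) \<partial>lborel) \<le> ennreal K"
  shows "(\<integral>y. F (Complex x\<^sub>1 y) \<partial>lborel) = (\<integral>y. F (Complex x\<^sub>2 y) \<partial>lborel)"
proof -
  define S where "S = {z. \<alpha> < Re z \<and> Re z < \<beta>}"
  have S: "open S" "convex S"
  proof -
    have "S = {z. \<alpha> < Re z} \<inter> {z. Re z < \<beta>}" by (auto simp: S_def)
    then show "open S" "convex S"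
      by (auto simp: open_halfspace_Re_gt open_halfspace_Re_lt convex_halfspace_Re_gt
          convex_halfspace_Re_lt intro!: open_Int convex_Int)
  qed
  obtain P where P: "\<And>z. z \<in> S \<Longrightarrow> (P has_field_derivative F z) (at z)"
    using holomorphic_convex_primitive'[OF S(2,1)] hol S(1)
    by (metis S_def at_within_open)
  have contF: "continuous_on S F"
    using hol by (simp add: S_def holomorphic_on_imp_continuous_on)
  have inS: "Complex x y \<in> S" if "x \<in> {x\<^sub>1..x\<^sub>2}" for x y
    using that x by (auto simp: S_def)
  have cC: "continuous_on A (\<lambda>p. Complex (fst p) (snd p))" for A
    unfolding Complex_eq by (intro continuous_intros)
  have contF2: "continuous_on ({x\<^sub>1..x\<^sub>2} \<times> UNIV) (\<lambda>p. F (Complex (fst p) (snd p)))"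
    using inS by (intro continuous_on_compose2[OF contF cC]) auto
  have cont_line: "continuous_on UNIV (\<lambda>y. F (Complex x y))" if "x \<in> {x\<^sub>1..x\<^sub>2}" for x
    using that by (intro continuous_on_compose2[OF contF2, of _ "\<lambda>y. (x, y)", simplified]) (auto intro: continuous_intros)
  have cont_seg: "continuous_on {x\<^sub>1..x\<^sub>2} (\<lambda>x. F (Complex x y))" for y
    by (intro continuous_on_compose2[OF contF2, of _ "\<lambda>x. (x, y)", simplified]) (auto intro: continuous_intros)
  have int_line: "integrable lborel (\<lambda>y. F (Complex x y))" if "x \<in> {x\<^sub>1..x\<^sub>2}" for x
  proof (rule integrableI_bounded)
    show "(\<lambda>y. F (Complex x y)) \<in> borel_measurable lborel"
      using cont_line[OF that] by (simp add: borel_measurable_continuous_onI)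
    show "(\<integral>\<^sup>+y. ennreal (cmod (F (Complex x y))) \<partial>lborel) < \<infinity>"
      using bound[OF that] by (simp add: le_less_trans)
  qed
  define G where "G = (\<lambda>y. P (Complex x\<^sub>2 y) - P (Complex x\<^sub>1 y))"
  define G' where "G' = (\<lambda>y. \<i> * F (Complex x\<^sub>2 y) - \<i> * F (Complex x\<^sub>1 y))"
  have derP: "((\<lambda>y. P (Complex x y)) has_vector_derivative \<i> * F (Complex x y)) (at y)"
    if "x \<in> {x\<^sub>1..x\<^sub>2}" for x y
  proof -
    have "((\<lambda>y. Complex x y) has_vector_derivative \<i>) (at y)"
      unfolding Complex_eq by (auto intro!: derivative_eq_intros)
    from field_vector_diff_chain_at[OF this P[OF inS[OF that]]] show ?thesis
      by (simp add: o_def)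
  qed
  have "(\<integral>y. G' y \<partial>lborel) = 0"
  proof (rule integral_derivative_eq_0)
    show "(G has_vector_derivative G' y) (at y)" for y
      unfolding G_def G'_def using x by (intro has_vector_derivative_diff derP) auto
    show "continuous_on UNIV G'"
      unfolding G'_def using x by (intro continuous_intros cont_line) auto
    show "integrable lborel G'"
      unfolding G'_def using x by (intro Bochner_Integration.integrable_diff integrable_mult_right int_line) auto
    have seg: "G y = (\<integral>t. indicator {x\<^sub>1..x\<^sub>2} t *\<^sub>R F (Complex t y) \<partial>lborel)" for y
    proof -
      have "((\<lambda>t. P (Complex t y)) has_vector_derivative F (Complex t y)) (at t within {x\<^sub>1..x\<^sub>2})"
        if "t \<in> {x\<^sub>1..x\<^sub>2}" for t
      proof -
        have "((\<lambda>t. Complex t y) has_vector_derivative 1) (at t)"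
          unfolding Complex_eq by (auto intro!: derivative_eq_intros)
        from field_vector_diff_chain_at[OF this P[OF inS[OF that]]] show ?thesis
          by (simp add: o_def has_vector_derivative_at_within)
      qed
      from integral_FTC_Icc[OF x(2) this cont_seg] show ?thesis
        by (simp add: G_def)
    qed
    show "integrable lborel G"
    proof (rule integrableI_bounded)
      have "continuous_on UNIV G"
        unfolding G_def using x
        by (intro continuous_at_imp_continuous_on ballI continuous_diff
             has_vector_derivative_continuous[OF derP]) auto
      then show "G \<in> borel_measurable lborel"
        by (simp add: borel_measurable_continuous_onI)
      define L where "L = (\<lambda>t y. ennreal (norm (indicator ({x\<^sub>1..x\<^sub>2} \<times> (UNIV :: real set)) (t, y) *\<^sub>R F (Complex t y))))"
      have "(\<lambda>p. indicator ({x\<^sub>1..x\<^sub>2} \<times> (UNIV :: real set)) p *\<^sub>R F (Complex (fst p) (snd p))) \<in> borel_measurable borel"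
        by (rule borel_measurable_continuous_on_indicator[OF _ contF2])
           (auto intro!: borel_closed closed_Times)
      then have Lm: "case_prod L \<in> borel_measurable (lborel \<Otimes>\<^sub>M lborel)"
        by (simp add: L_def lborel_prod split_beta' del: norm_scaleR)
      have "(\<integral>\<^sup>+y. ennreal (norm (G y)) \<partial>lborel) \<le> (\<integral>\<^sup>+y. \<integral>\<^sup>+t. L t y \<partial>lborel \<partial>lborel)"
      proof (rule nn_integral_mono)
        fix y
        have "ennreal (norm (G y)) \<le> (\<integral>\<^sup>+t. ennreal (norm (indicator {x\<^sub>1..x\<^sub>2} t *\<^sub>R F (Complex t y))) \<partial>lborel)"
          unfolding seg by (rule integral_norm_bound_ennreal)
             (auto intro!: borel_integrable_compact cont_seg)
        also have "\<dots> = (\<integral>\<^sup>+t. L t y \<partial>lborel)"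
          by (simp add: L_def indicator_def)
        finally show "ennreal (norm (G y)) \<le> (\<integral>\<^sup>+t. L t y \<partial>lborel)" .
      qed
      also have "\<dots> = (\<integral>\<^sup>+t. \<integral>\<^sup>+y. L t y \<partial>lborel \<partial>lborel)"
        by (rule lborel_pair.Fubini'[OF Lm])
      also have "\<dots> \<le> (\<integral>\<^sup>+t. ennreal K * indicator {x\<^sub>1..x\<^sub>2} t \<partial>lborel)"
        by (intro nn_integral_mono) (auto simp: L_def indicator_def bound)
      also have "\<dots> < \<infinity>"
        using x by (simp add: nn_integral_cmult ennreal_mult_less_top)
      finally show "(\<integral>\<^sup>+y. ennreal (norm (G y)) \<partial>lborel) < \<infinity>" .
    qed
  qed
  then show ?thesis
    unfolding G'_def using x by (simp add: int_line)
qed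

section \<open>Energies on vertical lines\<close>

definition in_hardy :: "(complex \<Rightarrow> complex) \<Rightarrow> bool" where
  "in_hardy f \<longleftrightarrow> f holomorphic_on right_half_plane \<and> hardy_energy f < \<infinity>"

definition pairing :: "(complex \<Rightarrow> complex) \<Rightarrow> (complex \<Rightarrow> complex) \<Rightarrow> real \<Rightarrow> real \<Rightarrow> complex" where
  "pairing f g x s = (\<integral>y. f (Complex x y) * cnj (g (Complex s y)) \<partial>lborel)"

definition line_energy :: "(complex \<Rightarrow> complex) \<Rightarrow> real \<Rightarrow> real" where
  "line_energy f x = (\<integral>y. (cmod (f (Complex x y)))\<^sup>2 \<partial>lborel)"

lemma line_energy_nonneg: "line_energy f x \<ge> 0"
  unfolding line_energy_def by simp

lemma continuous_on_line:
  assumes "f holomorphic_on right_half_plane" "x > 0"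
  shows "continuous_on UNIV (\<lambda>y. f (Complex x y))"
proof (rule continuous_on_compose2[OF holomorphic_on_imp_continuous_on[OF assms(1)]])
  show "continuous_on UNIV (\<lambda>y. Complex x y)"
    unfolding Complex_eq by (intro continuous_intros)
qed (use assms(2) in \<open>auto simp: right_half_plane_def\<close>)

lemma isCont_half_plane:
  assumes "f holomorphic_on right_half_plane" "w \<in> right_half_plane"
  shows "isCont f w"
  using holomorphic_on_imp_continuous_on[OF assms(1)] assms(2)
  by (simp add: continuous_on_eq_continuous_at right_half_plane_def open_halfspace_Re_gt)

lemma holomorphic_on_cnj_half_plane:
  assumes "g holomorphic_on right_half_plane"
  shows "(\<lambda>z. cnj (g (cnj z))) holomorphic_on right_half_plane"
proof -
  have "cnj ` right_half_plane = right_half_plane"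
    by (auto simp: right_half_plane_def image_iff intro!: exI[of _ "cnj _"])
  moreover have "open right_half_plane"
    by (simp add: right_half_plane_def open_halfspace_Re_gt)
  ultimately have "(cnj \<circ> g \<circ> cnj) holomorphic_on right_half_plane"
    using assms by (intro holomorphic_on_compose_cnj_cnj) auto
  then show ?thesis by (simp add: o_def)
qed

lemma nn_line_energy_le:
  "x > 0 \<Longrightarrow> (\<integral>\<^sup>+y. ennreal ((cmod (f (Complex x y)))\<^sup>2) \<partial>lborel) \<le> hardy_energy f"
  unfolding hardy_energy_def by (intro SUP_upper) auto

context
  fixes f assumes f: "in_hardy f"
begin

lemma measurable_line:
  "x > 0 \<Longrightarrow> (\<lambda>y. f (Complex x y)) \<in> borel_measurable borel"
  using f continuous_on_line by (auto simp: in_hardy_def intro: borel_measurable_continuous_onI)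

lemma integrable_line_energy:
  assumes "x > 0"
  shows "integrable lborel (\<lambda>y. (cmod (f (Complex x y)))\<^sup>2)"
proof (rule integrableI_bounded)
  show "(\<lambda>y. (cmod (f (Complex x y)))\<^sup>2) \<in> borel_measurable lborel"
    using measurable_line[OF assms] by simp
  show "(\<integral>\<^sup>+y. ennreal (norm ((cmod (f (Complex x y)))\<^sup>2)) \<partial>lborel) < \<infinity>"
    using le_less_trans[OF nn_line_energy_le[OF assms, of f]] f by (simp add: in_hardy_def)
qed

lemma ennreal_line_energy:
  assumes "x > 0"
  shows "ennreal (line_energy f x) = (\<integral>\<^sup>+y. ennreal ((cmod (f (Complex x y)))\<^sup>2) \<partial>lborel)"
  unfolding line_energy_def using integrable_line_energy[OF assms]
  by (simp add: nn_integral_eq_integral)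

lemma ennreal_hardy_energy:
  "ennreal (enn2real (hardy_energy f)) = hardy_energy f"
  using f by (simp add: in_hardy_def)

lemma line_energy_le:
  assumes "x > 0"
  shows "line_energy f x \<le> enn2real (hardy_energy f)"
proof -
  have "ennreal (line_energy f x) \<le> ennreal (enn2real (hardy_energy f))"
    using nn_line_energy_le[OF assms] by (simp add: ennreal_line_energy[OF assms] ennreal_hardy_energy)
  then show ?thesis by (simp add: line_energy_nonneg)
qed

end

lemma mult_le_half_squares: "(u::real) * v \<le> (u\<^sup>2 + v\<^sup>2) / 2"
  using sum_squares_bound[of u v] by simp

lemma integrable_pairing:
  assumes "in_hardy f" "in_hardy g" "x > 0" "s > 0"
  shows "integrable lborel (\<lambda>y. f (Complex x y) * cnj (g (Complex s y)))"
proof (rule Bochner_Integration.integrable_bound)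
  show "integrable lborel (\<lambda>y. ((cmod (f (Complex x y)))\<^sup>2 + (cmod (g (Complex s y)))\<^sup>2) / 2)"
    using assms by (intro integrable_divide Bochner_Integration.integrable_add integrable_line_energy)
  show "(\<lambda>y. f (Complex x y) * cnj (g (Complex s y))) \<in> borel_measurable lborel"
    using assms
    by (auto simp: in_hardy_def intro!: borel_measurable_continuous_onI continuous_on_mult
        continuous_on_cnj continuous_on_line)
qed (use mult_le_half_squares in \<open>simp add: norm_mult\<close>)

lemma norm_pairing_le:
  assumes "in_hardy f" "in_hardy g" "x > 0" "s > 0"
  shows "cmod (pairing f g x s) \<le> (line_energy f x + line_energy g s) / 2"
proof -
  have "cmod (pairing f g x s) \<le>
      (\<integral>y. ((cmod (f (Complex x y)))\<^sup>2 + (cmod (g (Complex s y)))\<^sup>2) / 2 \<partial>lborel)"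
    unfolding pairing_def
    by (rule order_trans[OF integral_norm_bound integral_mono[OF integrable_norm]])
       (use assms mult_le_half_squares in \<open>auto simp: norm_mult intro!: integrable_pairing
          integrable_divide Bochner_Integration.integrable_add integrable_line_energy\<close>)
  also have "\<dots> = (line_energy f x + line_energy g s) / 2"
    using assms by (simp add: line_energy_def integrable_line_energy)
  finally show ?thesis .
qed

text \<open>
  The integrand of the left side is the value at $iy$, and that of the right side the value at
  $b+iy$, of the holomorphic function $z \mapsto f(x+z)\, \overline{g(\overline{s+b-z})}$: along
  imaginary directions the antiholomorphic factor can be rewritten by reflection.
\<close>

lemma pairing_shift:
  assumes f: "in_hardy f" and g: "in_hardy g" and "x > 0" "s > 0" "b \<ge> 0"
  shows "pairing f g x (s + b) = pairing f g (x + b) s"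
proof -
  define F where "F = (\<lambda>z. f (of_real x + z) * cnj (g (cnj (of_real (s + b) - z))))"
  have F_line: "F (Complex t y) = f (Complex (x + t) y) * cnj (g (Complex (s + b - t) y))" for t y
  proof -
    have "of_real x + Complex t y = Complex (x + t) y"
      "cnj (of_real (s + b) - Complex t y) = Complex (s + b - t) y"
      by (auto simp: complex_eq_iff)
    then show ?thesis by (simp add: F_def)
  qed
  have "(\<integral>y. F (Complex 0 y) \<partial>lborel) = (\<integral>y. F (Complex b y) \<partial>lborel)"
  proof (rule line_integral_shift)
    have "(f \<circ> (\<lambda>z. of_real x + z)) holomorphic_on {z. - x < Re z \<and> Re z < s + b}"
      by (rule holomorphic_on_compose_gen[where t = right_half_plane])
         (use f in \<open>auto simp: in_hardy_def right_half_plane_def intro!: holomorphic_intros\<close>)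
    moreover have "(\<lambda>z. cnj (g (cnj z))) holomorphic_on right_half_plane"
      using g by (auto simp: in_hardy_def intro: holomorphic_on_cnj_half_plane)
    then have "((\<lambda>z. cnj (g (cnj z))) \<circ> (\<lambda>z. of_real (s + b) - z))
        holomorphic_on {z. - x < Re z \<and> Re z < s + b}"
      by (rule holomorphic_on_compose_gen[rotated])
         (auto simp: right_half_plane_def intro!: holomorphic_intros)
    ultimately show "F holomorphic_on {z. - x < Re z \<and> Re z < s + b}"
      unfolding F_def by (auto simp: o_def intro!: holomorphic_intros)
    show "(\<integral>\<^sup>+y. ennreal (cmod (F (Complex t y))) \<partial>lborel)
        \<le> ennreal (enn2real (hardy_energy f) + enn2real (hardy_energy g))" if "t \<in> {0..b}" for t
    proof -
      have t: "x + t > 0" "s + b - t > 0" using that assms by auto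
      have "(\<integral>\<^sup>+y. ennreal (cmod (F (Complex t y))) \<partial>lborel)
        \<le> (\<integral>\<^sup>+y. ennreal ((cmod (f (Complex (x + t) y)))\<^sup>2)
              + ennreal ((cmod (g (Complex (s + b - t) y)))\<^sup>2) \<partial>lborel)"
      proof (rule nn_integral_mono)
        fix y
        have "cmod (F (Complex t y)) \<le> (cmod (f (Complex (x + t) y)))\<^sup>2 + (cmod (g (Complex (s + b - t) y)))\<^sup>2"
          unfolding F_line norm_mult complex_mod_cnj
          by (rule order_trans[OF mult_le_half_squares]) auto
        then show "ennreal (cmod (F (Complex t y))) \<le> ennreal ((cmod (f (Complex (x + t) y)))\<^sup>2)
              + ennreal ((cmod (g (Complex (s + b - t) y)))\<^sup>2)"
          by (simp flip: ennreal_plus add: ennreal_leI)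
      qed
      also have "\<dots> = (\<integral>\<^sup>+y. ennreal ((cmod (f (Complex (x + t) y)))\<^sup>2) \<partial>lborel)
              + (\<integral>\<^sup>+y. ennreal ((cmod (g (Complex (s + b - t) y)))\<^sup>2) \<partial>lborel)"
        using measurable_line[OF f t(1)] measurable_line[OF g t(2)] by (intro nn_integral_add) auto
      also have "\<dots> \<le> hardy_energy f + hardy_energy g"
        using t by (intro add_mono nn_line_energy_le)
      also have "\<dots> = ennreal (enn2real (hardy_energy f) + enn2real (hardy_energy g))"
        by (simp add: ennreal_plus ennreal_hardy_energy f g)
      finally show ?thesis .
    qed
  qed (use assms in auto)
  then show ?thesis by (simp add: F_line pairing_def)
qed

lemma pairing_self: "pairing f f x x = of_real (line_energy f x)"
  unfolding pairing_def line_energy_def complex_norm_square[symmetric]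
  by (simp flip: of_real_power)

text \<open>
  A rise from $x$ to $y$ would, by midpoint convexity, be repeated at least as steeply on every
  later step of length $y - x$, and the function would be unbounded.
\<close>

lemma bounded_midpoint_convex_imp_decreasing:
  fixes M :: "real \<Rightarrow> real"
  assumes mid: "\<And>x s. 0 < x \<Longrightarrow> 0 < s \<Longrightarrow> 2 * M ((x + s) / 2) \<le> M x + M s"
    and bounded: "\<And>x. 0 < x \<Longrightarrow> M x \<le> K"
    and "0 < x" "x \<le> y"
  shows "M y \<le> M x"
proof (rule ccontr)
  assume *: "\<not> M y \<le> M x"
  define d where "d = y - x"
  define e where "e = M y - M x"
  have "d > 0" "e > 0" using * assms(4) by (auto simp: d_def e_def order.order_iff_strict)
  define u where "u = (\<lambda>k::nat. M (x + real k * d))"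
  have pos: "x + real k * d > 0" for k
    using \<open>d > 0\<close> \<open>0 < x\<close> by (simp add: add_pos_nonneg)
  \<comment> \<open>The increments of \<open>M\<close> along the arithmetic progression through \<open>x\<close> and \<open>y\<close> do not decrease.\<close>
  have step: "u (Suc k) - u k \<ge> e" for k
  proof (induction k)
    case 0
    then show ?case by (simp add: u_def d_def e_def)
  next
    case (Suc k)
    have "(x + real k * d + (x + real (Suc (Suc k)) * d)) / 2 = x + real (Suc k) * d"
      by (simp add: field_simps)
    with mid[OF pos[of k] pos[of "Suc (Suc k)"]] have "2 * u (Suc k) \<le> u k + u (Suc (Suc k))"
      by (simp only: u_def)
    with Suc show ?case by linarith
  qed
  have lower: "u k \<ge> u 0 + real k * e" for k
  proof (induction k)
    case (Suc k)
    with step[of k] show ?case by (simp add: algebra_simps)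
  qed simp
  obtain k where "real k * e > K - u 0"
    using reals_Archimedean3[OF \<open>e > 0\<close>] by blast
  with lower[of k] bounded[OF pos[of k]] show False by (simp add: u_def)
qed

text \<open>
  The energy on the line halfway between $x$ and $s$ is the pairing of the lines $x$ and $s$, by
  \<open>pairing_shift\<close>; this makes it midpoint convex.
\<close>

lemma line_energy_antimono:
  assumes f: "in_hardy f" and "0 < x" "x \<le> y"
  shows "line_energy f y \<le> line_energy f x"
proof (rule bounded_midpoint_convex_imp_decreasing[OF _ line_energy_le[OF f] assms(2,3)])
  have ordered: "2 * line_energy f ((x + s) / 2) \<le> line_energy f x + line_energy f s"
    if "0 < x" "x \<le> s" for x s
  proof -
    let ?m = "(x + s) / 2"
    have m: "?m + (s - x) / 2 = s" "x + (s - x) / 2 = ?m" by (simp_all add: field_simps)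
    have "pairing f f ?m ?m = pairing f f x s"
      using pairing_shift[OF f f, of x ?m "(s - x) / 2"] that unfolding m by simp
    then have "of_real (line_energy f ?m) = pairing f f x s"
      by (simp only: pairing_self)
    then have "line_energy f ?m = cmod (pairing f f x s)"
      by (metis abs_of_nonneg line_energy_nonneg norm_of_real)
    then show ?thesis
      using norm_pairing_le[OF f f, of x s] that by simp
  qed
  show "2 * line_energy f ((x + s) / 2) \<le> line_energy f x + line_energy f s" if "0 < x" "0 < s" for x s
    using ordered[of x s] ordered[of s x] that by (cases "x \<le> s") (auto simp: add.commute)
qed

text \<open>
  The supremum in the norm is a limit at the boundary, which makes the norm accessible to
  algebraic identities such as polarization.
\<close>

lemma line_energy_tendsto:
  assumes f: "in_hardy f"
  shows "(line_energy f \<longlongrightarrow> enn2real (hardy_energy f)) (at_right 0)"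
proof -
  let ?L = "\<lambda>x. \<integral>\<^sup>+y. ennreal ((cmod (f (Complex x y)))\<^sup>2) \<partial>lborel"
  have "(?L \<longlongrightarrow> hardy_energy f) (at_right 0)"
  proof (rule order_tendstoI)
    fix a assume "a < hardy_energy f"
    then obtain x where x: "x > 0" "a < ?L x"
      unfolding hardy_energy_def less_SUP_iff by auto
    have "a < ?L t" if "0 < t" "t < x" for t
    proof -
      have "ennreal (line_energy f x) \<le> ennreal (line_energy f t)"
        using line_energy_antimono[OF f, of t x] that by (intro ennreal_leI) auto
      with x that show ?thesis by (auto simp: ennreal_line_energy[OF f])
    qed
    then show "eventually (\<lambda>t. a < ?L t) (at_right 0)"
      using x(1) by (auto simp: eventually_at_right_field)
  next
    fix a assume "hardy_energy f < a"
    then show "eventually (\<lambda>t. ?L t < a) (at_right 0)"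
      using nn_line_energy_le[of _ f] le_less_trans
      by (auto simp: eventually_at_right_field intro!: exI[of _ 1])
  qed
  then have "((\<lambda>x. enn2real (?L x)) \<longlongrightarrow> enn2real (hardy_energy f)) (at_right 0)"
    using f by (intro tendsto_enn2real) (auto simp: in_hardy_def)
  moreover have "eventually (\<lambda>x. enn2real (?L x) = line_energy f x) (at_right 0)"
    unfolding eventually_at_right_field
    by (auto intro!: exI[of _ 1] simp: ennreal_line_energy[OF f, symmetric] line_energy_nonneg)
  ultimately show ?thesis by (rule Lim_transform_eventually)
qed

section \<open>The inner product and adjoints\<close>

lemma in_hardy_hardy_fun [simp]: "in_hardy (hardy_fun f)"
  using hardy_fun[of f] by (simp add: in_hardy_def)

lemma hardy_fun_outside: "w \<notin> right_half_plane \<Longrightarrow> hardy_fun f w = 0"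
  using hardy_fun[of f] by simp

lemma hardy2_eqI: "(\<And>w. w \<in> right_half_plane \<Longrightarrow> hardy_fun f w = hardy_fun g w) \<Longrightarrow> f = g"
  by (metis ext hardy_fun_inject hardy_fun_outside)

lemma power2_hardy_norm: "(hardy_norm f)\<^sup>2 = enn2real (hardy_energy (hardy_fun f))"
  by (simp add: hardy_norm_def)

lemma line_energy_add_mult:
  assumes f: "in_hardy f" and g: "in_hardy g" and x: "x > 0"
  shows "line_energy (\<lambda>w. f w + c * g w) x =
    line_energy f x + (cmod c)\<^sup>2 * line_energy g x + 2 * Re (cnj c * pairing f g x x)"
proof -
  have pw: "(cmod (u + c * v))\<^sup>2 = (cmod u)\<^sup>2 + (cmod c)\<^sup>2 * (cmod v)\<^sup>2 + 2 * Re (cnj c * (u * cnj v))" for u v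
    unfolding cmod_power2 by (simp add: power2_eq_square algebra_simps)
  have int: "integrable lborel (\<lambda>y. cnj c * (f (Complex x y) * cnj (g (Complex x y))))"
    by (intro integrable_mult_right integrable_pairing f g x)
  have "(\<integral>y. Re (cnj c * (f (Complex x y) * cnj (g (Complex x y)))) \<partial>lborel) = Re (cnj c * pairing f g x x)"
    using int by (simp add: integral_Re pairing_def del: times_complex.sel)
  then show ?thesis
    using int by (simp add: line_energy_def pw integrable_line_energy f g x integrable_Re
      del: times_complex.sel)
qed

text \<open>
  On each line the polarization identity is exact for the $L^2$ pairing; letting the line tend to
  the boundary turns the polarized norms into the inner product.
\<close>

lemma hardy_inner_tendsto:
  "((\<lambda>x. pairing (hardy_fun f) (hardy_fun g) x x) \<longlongrightarrow> hardy_inner f g) (at_right 0)"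
proof (rule Lim_transform_eventually)
  let ?S = "\<lambda>x. (\<Sum>k<4. \<i> ^ k * of_real (line_energy (hardy_fun (f + scaleC (\<i> ^ k) g)) x)) / 4"
  show "(?S \<longlongrightarrow> hardy_inner f g) (at_right 0)"
    unfolding hardy_inner_def power2_hardy_norm
    by (intro tendsto_divide tendsto_sum tendsto_mult tendsto_of_real line_energy_tendsto tendsto_const) auto
  have "?S x = pairing (hardy_fun f) (hardy_fun g) x x" if "x > 0" for x
  proof -
    have *: "line_energy (hardy_fun (f + scaleC (\<i> ^ k) g)) x =
      line_energy (hardy_fun f) x + line_energy (hardy_fun g) x
       + 2 * Re (cnj (\<i> ^ k) * pairing (hardy_fun f) (hardy_fun g) x x)" for k
      using line_energy_add_mult[of "hardy_fun f" "hardy_fun g" x "\<i> ^ k"] that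
      by (simp add: plus_hardy2.rep_eq scaleC.rep_eq norm_power)
    show ?thesis
      unfolding * by (simp add: eval_nat_numeral complex_eq_iff)
  qed
  then show "eventually (\<lambda>x. ?S x = pairing (hardy_fun f) (hardy_fun g) x x) (at_right 0)"
    by (auto simp: eventually_at_right_field intro!: exI[of _ 1])
qed

lemma hardy_inner_eqI:
  assumes "\<And>x. x > 0 \<Longrightarrow> pairing (hardy_fun f) (hardy_fun g) x x = P x"
    and "(P \<longlongrightarrow> l) (at_right 0)"
  shows "hardy_inner f g = l"
proof (rule tendsto_unique[OF _ hardy_inner_tendsto])
  show "((\<lambda>x. pairing (hardy_fun f) (hardy_fun g) x x) \<longlongrightarrow> l) (at_right 0)"
    by (rule Lim_transform_eventually[OF assms(2)])
       (auto simp: eventually_at_right_field assms(1) intro!: exI[of _ 1])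
qed simp

lemma hardy_inner_self: "hardy_inner f f = of_real ((hardy_norm f)\<^sup>2)"
  by (rule hardy_inner_eqI[OF pairing_self])
     (auto simp: power2_hardy_norm intro!: tendsto_of_real line_energy_tendsto)

lemma hardy_inner_add_scale_right:
  "hardy_inner f (g + scaleC c h) = hardy_inner f g + cnj c * hardy_inner f h"
proof (rule hardy_inner_eqI)
  fix x :: real assume x: "x > 0"
  have "integrable lborel (\<lambda>y. hardy_fun f (Complex x y) * cnj (hardy_fun g (Complex x y)))"
    "integrable lborel (\<lambda>y. cnj c * (hardy_fun f (Complex x y) * cnj (hardy_fun h (Complex x y))))"
    using x by (auto intro!: integrable_pairing integrable_mult_right)
  from Bochner_Integration.integral_add[OF this]
  show "pairing (hardy_fun f) (hardy_fun (g + scaleC c h)) x x =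
    pairing (hardy_fun f) (hardy_fun g) x x + cnj c * pairing (hardy_fun f) (hardy_fun h) x x"
    by (simp add: pairing_def plus_hardy2.rep_eq scaleC.rep_eq algebra_simps)
qed (intro tendsto_intros hardy_inner_tendsto)

lemma hardy_norm_eq_0D:
  assumes "hardy_norm f = 0"
  shows "f = 0"
proof (rule hardy2_eqI)
  fix w assume w: "w \<in> right_half_plane"
  let ?F = "\<lambda>y. hardy_fun f (Complex (Re w) y)"
  have pos: "Re w > 0" using w by (simp add: right_half_plane_def)
  have "hardy_energy (hardy_fun f) = 0"
    using assms ennreal_hardy_energy[of "hardy_fun f"] by (simp add: hardy_norm_def)
  then have "(\<integral>\<^sup>+y. ennreal ((cmod (?F y))\<^sup>2) \<partial>lborel) = 0"
    using nn_line_energy_le[OF pos, of "hardy_fun f"] by simp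
  then have "AE y in lborel. ?F y = 0"
    using measurable_line[OF in_hardy_hardy_fun pos, of f]
    by (subst (asm) nn_integral_0_iff_AE) auto
  then have ae: "AE y in lebesgue. y \<in> {y. ?F y = 0}"
    by (simp add: AE_completion)
  have "continuous_on UNIV ?F"
    using continuous_on_line[OF _ pos] in_hardy_hardy_fun[of f] by (simp add: in_hardy_def)
  then have "closed {y. ?F y = 0}"
    by (intro closed_Collect_eq continuous_on_const)
  from mem_closed_if_AE_lebesgue[OF this ae, of "Im w"] show "hardy_fun f w = hardy_fun 0 w"
    by (simp add: zero_hardy2.rep_eq)
qed

text \<open>
  Uniqueness of the vector that represents a functional, which is what the definite description in
  \<^const>\<open>hardy_adjoint\<close> depends on.
\<close>

lemma hardy_inner_right_cancel:
  assumes "\<And>f. hardy_inner f g = hardy_inner f h"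
  shows "g = h"
proof -
  have "hardy_inner (g + scaleC (-1) h) (g + scaleC (-1) h) = 0"
    unfolding hardy_inner_add_scale_right assms by simp
  then have "g + scaleC (-1) h = 0"
    by (intro hardy_norm_eq_0D) (simp add: hardy_inner_self flip: of_real_power)
  then show ?thesis
    by (simp add: hardy2.scale_minus_left add_eq_0_iff)
qed

lemma hardy_adjoint_eqI:
  assumes "\<And>f. hardy_inner (T f) g = hardy_inner f h"
  shows "hardy_adjoint T g = h"
  unfolding hardy_adjoint_def using assms
  by (intro the_equality) (auto intro: hardy_inner_right_cancel)

text \<open>
  Substituting $u = ay + \mathrm{Im}(b)$ moves the dilation and the vertical translation from $f$
  to $g$. What remains is the horizontal translation by $\mathrm{Re}(b)$, and \<open>pairing_shift\<close> moves it
  across.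
\<close>

lemma hardy_adjoint_composition_affine:
  assumes a: "a > 0" and b: "Re b \<ge> 0"
  shows "hardy_adjoint (composition_operator (\<lambda>w. of_real a * w + b)) g =
    scaleC (of_real (1 / a)) (composition_operator (\<lambda>w. of_real (1 / a) * w + cnj b / of_real a) g)"
proof (rule hardy_adjoint_eqI)
  fix f
  let ?T = "composition_operator (\<lambda>w. of_real a * w + b)"
  let ?S = "\<lambda>g. scaleC (of_real (1 / a)) (composition_operator (\<lambda>w. of_real (1 / a) * w + cnj b / of_real a) g)"
  have a': "1 / a > 0" and b': "Re (cnj b / of_real a) \<ge> 0"
    using a b by auto
  let ?F = "hardy_fun f" and ?G = "hardy_fun g"
  define H where "H = (\<lambda>w. ?G (of_real (1 / a) * w + Complex 0 (- Im b / a)))"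
  have H: "in_hardy H"
    unfolding in_hardy_def
  proof
    have "?G \<circ> (\<lambda>w. of_real (1 / a) * w + Complex 0 (- Im b / a)) holomorphic_on right_half_plane"
      by (rule holomorphic_on_compose_gen[where t = right_half_plane])
         (use in_hardy_hardy_fun[of g] affine_maps_half_plane[OF a', of "Complex 0 (- Im b / a)"]
          in \<open>auto simp: in_hardy_def intro!: holomorphic_intros\<close>)
    then show "H holomorphic_on right_half_plane"
      by (simp add: H_def o_def)
    have "hardy_energy H \<le> ennreal (1 / (1 / a)) * hardy_energy ?G"
      unfolding H_def using in_hardy_hardy_fun[of g] a'
      by (intro hardy_energy_affine) (auto simp: in_hardy_def)
    also have "\<dots> < \<infinity>"
      using in_hardy_hardy_fun[of g] by (simp add: in_hardy_def ennreal_mult_less_top)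
    finally show "hardy_energy H < \<infinity>" .
  qed
  have H_line: "H (Complex x u) = ?G (Complex (x / a) ((u - Im b) / a))" for x u
    unfolding H_def by (rule arg_cong[where f = ?G]) (use a in \<open>auto simp: complex_eq_iff field_simps\<close>)
  \<comment> \<open>The dilation maps the line over \<open>x / a\<close> to the line over \<open>x\<close>, up to the shift by \<open>Re b\<close>; both tend to the boundary together.\<close>
  have *: "pairing (hardy_fun (?T f)) ?G (x / a) (x / a) = pairing ?F (hardy_fun (?S g)) x x"
    if x: "x > 0" for x
  proof -
    have "pairing (hardy_fun (?T f)) ?G (x / a) (x / a) =
      (\<integral>y. ?F (Complex (x + Re b) (Im b + a * y)) * cnj (H (Complex x (Im b + a * y))) \<partial>lborel)"
      unfolding pairing_def
    proof (intro Bochner_Integration.integral_cong refl)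
      fix y
      have "of_real a * Complex (x / a) y + b = Complex (x + Re b) (Im b + a * y)"
        using a by (simp add: complex_eq_iff)
      then show "hardy_fun (?T f) (Complex (x / a) y) * cnj (?G (Complex (x / a) y)) =
         ?F (Complex (x + Re b) (Im b + a * y)) * cnj (H (Complex x (Im b + a * y)))"
        using a x by (simp add: hardy_fun_composition_affine[OF a b] H_line right_half_plane_def)
    qed
    also have "\<dots> = of_real (1 / a) * pairing ?F H (x + Re b) x"
      using lborel_integral_real_affine[of a "\<lambda>u. ?F (Complex (x + Re b) u) * cnj (H (Complex x u))" "Im b"] a
      by (simp add: pairing_def scaleR_conv_of_real)
    also have "pairing ?F H (x + Re b) x = pairing ?F H x (x + Re b)"
      using pairing_shift[OF in_hardy_hardy_fun H x x b] by simp
    also have "of_real (1 / a) * \<dots> = pairing ?F (hardy_fun (?S g)) x x"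
      unfolding pairing_def integral_mult_right_zero[symmetric]
    proof (intro Bochner_Integration.integral_cong refl)
      fix y
      have "of_real (1 / a) * Complex x y + cnj b / of_real a = Complex ((x + Re b) / a) ((y - Im b) / a)"
        using a by (simp add: complex_eq_iff field_simps)
      moreover have "Complex x y \<in> right_half_plane"
        using x by (simp add: right_half_plane_def)
      ultimately have "hardy_fun (?S g) (Complex x y) = of_real (1 / a) * H (Complex (x + Re b) y)"
        by (simp only: scaleC.rep_eq hardy_fun_composition_affine[OF a' b'] H_line if_True)
      then show "of_real (1 / a) * (?F (Complex x y) * cnj (H (Complex (x + Re b) y))) =
         ?F (Complex x y) * cnj (hardy_fun (?S g) (Complex x y))"
        by simp
    qed
    finally show ?thesis .
  qed
  have "((\<lambda>x. pairing (hardy_fun (?T f)) ?G (x / a) (x / a)) \<longlongrightarrow> hardy_inner (?T f) g) (at_right 0)"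
  proof (rule filterlim_compose[OF hardy_inner_tendsto])
    show "filterlim (\<lambda>x. x / a) (at_right 0) (at_right 0)"
      using a by (auto simp: filterlim_at eventually_at_right_field intro!: tendsto_eq_intros exI[of _ 1])
  qed
  then have "((\<lambda>x. pairing ?F (hardy_fun (?S g)) x x) \<longlongrightarrow> hardy_inner (?T f) g) (at_right 0)"
    by (rule Lim_transform_eventually) (auto simp: eventually_at_right_field * intro!: exI[of _ 1])
  then show "hardy_inner (?T f) g = hardy_inner f (?S g)"
    using tendsto_unique[OF _ _ hardy_inner_tendsto] by (simp add: trivial_limit_at_right_real)
qed

section \<open>Integrals over the real line\<close>

lemma nn_integral_le_of_tendsto:
  fixes u :: "nat \<Rightarrow> 'a \<Rightarrow> ennreal"
  assumes "\<And>n. u n \<in> borel_measurable M"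
    and "\<And>x. x \<in> space M \<Longrightarrow> (\<lambda>n. u n x) \<longlonglongrightarrow> v x"
    and "\<And>n. (\<integral>\<^sup>+x. u n x \<partial>M) \<le> K"
  shows "(\<integral>\<^sup>+x. v x \<partial>M) \<le> K"
proof -
  have "(\<integral>\<^sup>+x. v x \<partial>M) = (\<integral>\<^sup>+x. liminf (\<lambda>n. u n x) \<partial>M)"
    using assms(2) by (intro nn_integral_cong lim_imp_Liminf[symmetric]) auto
  also have "\<dots> \<le> liminf (\<lambda>n. \<integral>\<^sup>+x. u n x \<partial>M)"
    using assms(1) by (intro nn_integral_liminf)
  also have "\<dots> \<le> K"
    using assms(3) by (intro Liminf_le) auto
  finally show ?thesis .
qed

text \<open>
  The substitution $u = -1/y$, carried out on compact intervals away from the singularity at $0$.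
\<close>

lemma nn_integral_reciprocal_le:
  fixes G :: "real \<Rightarrow> ennreal"
  assumes [measurable]: "G \<in> borel_measurable borel"
  shows "(\<integral>\<^sup>+y. G (- 1 / y) * ennreal (1 / y\<^sup>2) \<partial>lborel) \<le> (\<integral>\<^sup>+u. G u \<partial>lborel)"
proof -
  \<comment> \<open>The offset 2 makes the intervals nondegenerate already for \<open>n = 0\<close>.\<close>
  define N where "N = (\<lambda>n. real n + 2)"
  define Ap where "Ap = (\<lambda>n. {1 / N n..N n})"
  define An where "An = (\<lambda>n. {- N n..- 1 / N n})"
  have N: "N n \<ge> 2" for n by (simp add: N_def)
  have lt: "1 / N n < N n" for n
  proof -
    have "1 / N n \<le> 1 / 2" using N[of n] by (intro divide_left_mono) auto
    with N[of n] show ?thesis by linarith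
  qed
  have disj: "y \<notin> An n" if "y \<in> Ap n" for n y
    using that N[of n] by (auto simp: Ap_def An_def field_simps)
  have subst: "(\<integral>\<^sup>+y. G (- 1 / y) * ennreal (1 / y\<^sup>2) * indicator {a..b} y \<partial>lborel) =
      (\<integral>\<^sup>+u. G u * indicator {- 1 / a..- 1 / b} u \<partial>lborel)" if "a < b" "0 \<notin> {a..b}" for a b
  proof (rule nn_integral_substitution_aux[symmetric])
    show "((\<lambda>y. - 1 / y) has_real_derivative 1 / y\<^sup>2) (at y)" if "y \<in> {a..b}" for y
    proof -
      have "y \<noteq> 0" using that \<open>0 \<notin> {a..b}\<close> by metis
      then show ?thesis
        by (auto intro!: derivative_eq_intros simp: power2_eq_square)
    qed
    show "continuous_on {a..b} (\<lambda>y. 1 / y\<^sup>2)"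
      using that by (intro continuous_intros) auto
  qed (use that in auto)
  show ?thesis
  proof (rule nn_integral_le_of_tendsto)
    fix n
    have "(\<integral>\<^sup>+y. G (- 1 / y) * ennreal (1 / y\<^sup>2) * indicator (Ap n \<union> An n) y \<partial>lborel) =
      (\<integral>\<^sup>+y. G (- 1 / y) * ennreal (1 / y\<^sup>2) * indicator (Ap n) y
        + G (- 1 / y) * ennreal (1 / y\<^sup>2) * indicator (An n) y \<partial>lborel)"
      using disj by (intro nn_integral_cong) (auto simp: indicator_def)
    also have "\<dots> = (\<integral>\<^sup>+y. G (- 1 / y) * ennreal (1 / y\<^sup>2) * indicator (Ap n) y \<partial>lborel)
        + (\<integral>\<^sup>+y. G (- 1 / y) * ennreal (1 / y\<^sup>2) * indicator (An n) y \<partial>lborel)"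
      unfolding Ap_def An_def by (intro nn_integral_add) auto
    also have "(\<integral>\<^sup>+y. G (- 1 / y) * ennreal (1 / y\<^sup>2) * indicator (Ap n) y \<partial>lborel) =
        (\<integral>\<^sup>+u. G u * indicator (An n) u \<partial>lborel)"
      using subst[of "1 / N n" "N n"] lt[of n] N[of n] by (simp add: Ap_def An_def)
    also have "(\<integral>\<^sup>+y. G (- 1 / y) * ennreal (1 / y\<^sup>2) * indicator (An n) y \<partial>lborel) =
        (\<integral>\<^sup>+u. G u * indicator (Ap n) u \<partial>lborel)"
      using subst[of "- N n" "- 1 / N n"] lt[of n] N[of n] by (simp add: Ap_def An_def)
    also have "(\<integral>\<^sup>+u. G u * indicator (An n) u \<partial>lborel) + (\<integral>\<^sup>+u. G u * indicator (Ap n) u \<partial>lborel)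
        = (\<integral>\<^sup>+u. G u * indicator (An n) u + G u * indicator (Ap n) u \<partial>lborel)"
      unfolding Ap_def An_def by (intro nn_integral_add[symmetric]) auto
    also have "\<dots> \<le> (\<integral>\<^sup>+u. G u \<partial>lborel)"
      using disj by (intro nn_integral_mono) (auto simp: indicator_def)
    finally show "(\<integral>\<^sup>+y. G (- 1 / y) * ennreal (1 / y\<^sup>2) * indicator (Ap n \<union> An n) y \<partial>lborel)
        \<le> (\<integral>\<^sup>+u. G u \<partial>lborel)" .
  next
    fix y :: real
    show "(\<lambda>n. G (- 1 / y) * ennreal (1 / y\<^sup>2) * indicator (Ap n \<union> An n) y)
        \<longlonglongrightarrow> G (- 1 / y) * ennreal (1 / y\<^sup>2)"
    proof (cases "y = 0")
      case False
      obtain m where m: "real m > \<bar>y\<bar> + 1 / \<bar>y\<bar>"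
        using reals_Archimedean2 by blast
      have "y \<in> Ap n \<union> An n" if "n \<ge> m" for n
      proof -
        have "\<bar>y\<bar> > 0" "1 / \<bar>y\<bar> > 0" using False by auto
        then have Nn: "\<bar>y\<bar> < N n" "1 / \<bar>y\<bar> < N n"
          using m that unfolding N_def by linarith+
        then have "1 / N n < \<bar>y\<bar>"
          using \<open>\<bar>y\<bar> > 0\<close> N[of n] by (simp add: field_simps)
        with Nn show ?thesis by (auto simp: Ap_def An_def abs_if split: if_splits)
      qed
      then have "eventually (\<lambda>n. G (- 1 / y) * ennreal (1 / y\<^sup>2) * indicator (Ap n \<union> An n) y
          = G (- 1 / y) * ennreal (1 / y\<^sup>2)) sequentially"
        by (auto simp: eventually_sequentially intro!: exI[of _ m])
      then show ?thesis by (rule tendsto_eventually)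
    qed simp
  qed (auto simp: Ap_def An_def)
qed

lemma nn_integral_inverse_quadratic_finite:
  assumes "c > 0"
  shows "(\<integral>\<^sup>+y. ennreal (K / (c\<^sup>2 + y\<^sup>2)) \<partial>lborel) < \<infinity>"
proof -
  have "integrable lborel (\<lambda>y::real. inverse (1 + y\<^sup>2))"
    using integrable_inverse_1_plus_square by (simp add: set_integrable_def)
  from lborel_integrable_real_affine[OF this, of "1 / c" 0] assms
  have "integrable lborel (\<lambda>y. K / c\<^sup>2 * inverse (1 + (y / c)\<^sup>2))"
    by (intro integrable_mult_right) simp
  also have "(\<lambda>y. K / c\<^sup>2 * inverse (1 + (y / c)\<^sup>2)) = (\<lambda>y. K / (c\<^sup>2 + y\<^sup>2))"
  proof
    fix y
    have "c\<^sup>2 + y\<^sup>2 > 0" using assms by (intro add_pos_nonneg) auto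
    then show "K / c\<^sup>2 * inverse (1 + (y / c)\<^sup>2) = K / (c\<^sup>2 + y\<^sup>2)"
      using assms by (simp add: power_divide field_simps)
  qed
  finally have "integrable lborel (\<lambda>y. K / (c\<^sup>2 + y\<^sup>2))" .
  then have "(\<integral>\<^sup>+y. ennreal (norm (K / (c\<^sup>2 + y\<^sup>2))) \<partial>lborel) < \<infinity>"
    by (simp only: integrable_iff_bounded)
  then show ?thesis
    by (rule le_less_trans[rotated]) (intro nn_integral_mono ennreal_leI, simp add: divide_right_mono)
qed

lemma power2_cmod_le_of_decay:
  assumes "c > 0" "Re w \<ge> 0" "cmod z \<le> K / cmod (w + of_real c)"
  shows "(cmod z)\<^sup>2 \<le> K\<^sup>2 / (c\<^sup>2 + (Im w)\<^sup>2)"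
proof -
  have le: "c\<^sup>2 + (Im w)\<^sup>2 \<le> (cmod (w + of_real c))\<^sup>2"
    unfolding cmod_power2 using assms by (simp add: power_mono)
  have "c\<^sup>2 + (Im w)\<^sup>2 > 0"
    using assms by (intro add_pos_nonneg) auto
  have "(cmod z)\<^sup>2 \<le> (K / cmod (w + of_real c))\<^sup>2"
    using assms by (intro power_mono) auto
  also have "\<dots> = K\<^sup>2 / (cmod (w + of_real c))\<^sup>2"
    by (simp add: power_divide)
  also have "\<dots> \<le> K\<^sup>2 / (c\<^sup>2 + (Im w)\<^sup>2)"
    using le \<open>c\<^sup>2 + (Im w)\<^sup>2 > 0\<close> by (intro divide_left_mono mult_pos_pos zero_le_power2) linarith+
  finally show ?thesis .
qed

lemma in_hardy_of_decay:
  assumes "h holomorphic_on right_half_plane" and c: "c > 0"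
    and "\<And>w. w \<in> right_half_plane \<Longrightarrow> cmod (h w) \<le> K / cmod (w + of_real c)"
  shows "in_hardy h"
proof -
  have "hardy_energy h \<le> (\<integral>\<^sup>+y. ennreal (K\<^sup>2 / (c\<^sup>2 + y\<^sup>2)) \<partial>lborel)"
    unfolding hardy_energy_def
  proof (rule SUP_least)
    fix x :: real assume "x \<in> {0<..}"
    then have "(cmod (h (Complex x y)))\<^sup>2 \<le> K\<^sup>2 / (c\<^sup>2 + y\<^sup>2)" for y
      using power2_cmod_le_of_decay[OF c, of "Complex x y" "h (Complex x y)" K] assms(3)
      by (simp add: right_half_plane_def)
    then show "(\<integral>\<^sup>+y. ennreal ((cmod (h (Complex x y)))\<^sup>2) \<partial>lborel)
        \<le> (\<integral>\<^sup>+y. ennreal (K\<^sup>2 / (c\<^sup>2 + y\<^sup>2)) \<partial>lborel)"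
      by (intro nn_integral_mono ennreal_leI)
  qed
  also have "\<dots> < \<infinity>"
    using c by (rule nn_integral_inverse_quadratic_finite)
  finally show ?thesis using assms(1) by (simp add: in_hardy_def)
qed

section \<open>Means over vertical segments\<close>

text \<open>
  The mean of $f$ over the segment from $w + e$ to $w + e + ie$. It is holomorphic beyond the
  imaginary axis, bounded, not larger than $f$ in energy, and close to $f$ for small $e$: the
  regularization through which inversion is analysed.
\<close>

definition segment_mean :: "(complex \<Rightarrow> complex) \<Rightarrow> real \<Rightarrow> complex \<Rightarrow> complex" where
  "segment_mean f e w = (\<integral>s. indicator {0..1} s *\<^sub>R f (w + Complex e (e * s)) \<partial>lborel)"

lemma shift_in_half_plane: "Re w > - e \<Longrightarrow> w + Complex e t \<in> right_half_plane"
  by (simp add: right_half_plane_def)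

lemma continuous_on_segment:
  assumes "f holomorphic_on right_half_plane" "Re w > - e"
  shows "continuous_on A (\<lambda>s. f (w + Complex e (e * s)))"
proof (rule continuous_on_compose2[OF holomorphic_on_imp_continuous_on[OF assms(1)]])
  show "continuous_on A (\<lambda>s. w + Complex e (e * s))"
    unfolding Complex_eq by (intro continuous_intros)
qed (use assms(2) in \<open>auto simp: shift_in_half_plane\<close>)

text \<open>
  The mean is a difference quotient of a primitive of $f$.
\<close>

lemma holomorphic_segment_mean:
  assumes f: "f holomorphic_on right_half_plane" and e: "e > 0"
  shows "segment_mean f e holomorphic_on {w. Re w > - e}"
proof -
  have S: "open right_half_plane" "convex right_half_plane"
    by (simp_all add: right_half_plane_def open_halfspace_Re_gt convex_halfspace_Re_gt)
  obtain P where P: "\<And>z. z \<in> right_half_plane \<Longrightarrow> (P has_field_derivative f z) (at z)"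
    using holomorphic_convex_primitive'[OF S(2,1) f] S(1) by (metis at_within_open)
  have eq: "segment_mean f e w = (P (w + Complex e e) - P (w + of_real e)) / (\<i> * of_real e)"
    if w: "Re w > - e" for w
  proof -
    have "((\<lambda>s. P (w + Complex e (e * s)) / (\<i> * of_real e)) has_vector_derivative
        f (w + Complex e (e * s))) (at s within {0..1})" for s
    proof -
      have "((\<lambda>s. w + Complex e (e * s)) has_vector_derivative \<i> * of_real e) (at s)"
        unfolding Complex_eq by (auto intro!: derivative_eq_intros)
      from field_vector_diff_chain_at[OF this P[OF shift_in_half_plane[OF w]]]
      have "((\<lambda>s. P (w + Complex e (e * s))) has_vector_derivative
          \<i> * of_real e * f (w + Complex e (e * s))) (at s)"
        by (simp add: o_def)
      from has_vector_derivative_divide[OF this, of "\<i> * of_real e"] show ?thesis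
        using e by (simp add: has_vector_derivative_at_within)
    qed
    from integral_FTC_Icc[OF _ this continuous_on_segment[OF f w]]
    show ?thesis by (simp add: segment_mean_def diff_divide_distrib complex_of_real_def[symmetric] flip: complex_of_real_def)
  qed
  have Ph: "P holomorphic_on right_half_plane"
    using P S(1) by (auto simp: holomorphic_on_open)
  have shifted: "(\<lambda>w. P (w + Complex e t)) holomorphic_on {w. Re w > - e}" for t
  proof -
    have "P \<circ> (\<lambda>w. w + Complex e t) holomorphic_on {w. Re w > - e}"
      by (rule holomorphic_on_compose_gen[OF _ Ph])
         (auto simp: shift_in_half_plane intro!: holomorphic_intros)
    then show ?thesis by (simp add: o_def)
  qed
  have "(\<lambda>w. (P (w + Complex e e) - P (w + of_real e)) / (\<i> * of_real e)) holomorphic_on {w. Re w > - e}"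
    using shifted[of e] shifted[of 0] e by (intro holomorphic_intros) (auto simp: complex_of_real_def)
  then show ?thesis
    by (rule holomorphic_transform) (simp add: eq)
qed

text \<open>
  Jensen's inequality for the square. It follows from $\int_0^1 (|f| - m)^2 \ge 0$, where $m$ is
  the mean of $|f|$ over the segment.
\<close>

lemma power2_norm_segment_mean_le:
  assumes f: "f holomorphic_on right_half_plane" and w: "Re w > - e"
  shows "ennreal ((cmod (segment_mean f e w))\<^sup>2) \<le>
    (\<integral>\<^sup>+s. indicator {0..1} s * ennreal ((cmod (f (w + Complex e (e * s))))\<^sup>2) \<partial>lborel)"
proof -
  define \<phi> where "\<phi> = (\<lambda>s. f (w + Complex e (e * s)))"
  have c: "continuous_on {0..1} \<phi>"
    unfolding \<phi>_def by (rule continuous_on_segment[OF f w])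
  define m where "m = (\<integral>s. indicator {0..1} s *\<^sub>R cmod (\<phi> s) \<partial>lborel)"
  have int: "integrable lborel (\<lambda>s::real. indicator {0..1} s *\<^sub>R g s)"
    if "continuous_on {0..1} g" for g :: "real \<Rightarrow> real"
    using that by (intro borel_integrable_compact) auto
  have int1: "integrable lborel (\<lambda>s. indicator {0..1} s *\<^sub>R cmod (\<phi> s))"
    and int2: "integrable lborel (\<lambda>s. indicator {0..1} s *\<^sub>R (cmod (\<phi> s))\<^sup>2)"
    by (intro int continuous_intros c)+
  have le: "cmod (segment_mean f e w) \<le> m"
    unfolding segment_mean_def m_def \<phi>_def
    by (rule order_trans[OF integral_norm_bound]) simp
  have "0 \<le> (\<integral>s. indicator {0..1} s *\<^sub>R (cmod (\<phi> s) - m)\<^sup>2 \<partial>lborel)"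
    by (intro Bochner_Integration.integral_nonneg) simp
  also have "\<dots> = (\<integral>s. indicator {0..1} s *\<^sub>R (cmod (\<phi> s))\<^sup>2
      - 2 * m * (indicator {0..1} s *\<^sub>R cmod (\<phi> s)) + m\<^sup>2 * indicator {0..1} s \<partial>lborel)"
    by (intro Bochner_Integration.integral_cong refl) (simp add: power2_eq_square algebra_simps)
  also have "\<dots> = (\<integral>s. indicator {0..1} s *\<^sub>R (cmod (\<phi> s))\<^sup>2 \<partial>lborel) - m\<^sup>2"
    using int1 int2 m_def by (simp add: power2_eq_square)
  finally have "(cmod (segment_mean f e w))\<^sup>2 \<le> (\<integral>s. indicator {0..1} s *\<^sub>R (cmod (\<phi> s))\<^sup>2 \<partial>lborel)"
    using power_mono[OF le norm_ge_zero, of 2] by simp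
  then have "ennreal ((cmod (segment_mean f e w))\<^sup>2) \<le> ennreal (\<integral>s. indicator {0..1} s *\<^sub>R (cmod (\<phi> s))\<^sup>2 \<partial>lborel)"
    by (rule ennreal_leI)
  also have "\<dots> = (\<integral>\<^sup>+s. ennreal (indicator {0..1} s *\<^sub>R (cmod (\<phi> s))\<^sup>2) \<partial>lborel)"
    using int2 by (intro nn_integral_eq_integral[symmetric]) auto
  also have "\<dots> = (\<integral>\<^sup>+s. indicator {0..1} s * ennreal ((cmod (f (w + Complex e (e * s))))\<^sup>2) \<partial>lborel)"
    by (intro nn_integral_cong) (auto simp: \<phi>_def indicator_def)
  finally show ?thesis .
qed

text \<open>
  The segment is part of a vertical line, on which $|f|^2$ has finite integral; the factor $1/e$ is
  the reciprocal of the length of the segment.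
\<close>

lemma norm_segment_mean_le:
  assumes f: "in_hardy f" and e: "e > 0" and w: "Re w > - e"
  shows "cmod (segment_mean f e w) \<le> sqrt (enn2real (hardy_energy f) / e)"
proof -
  have hol: "f holomorphic_on right_half_plane" and x: "Re w + e > 0"
    using f w by (auto simp: in_hardy_def)
  have pt: "w + Complex e (e * s) = Complex (Re w + e) (Im w + e * s)" for s
    by (simp add: complex_eq_iff)
  have "ennreal ((cmod (segment_mean f e w))\<^sup>2) \<le>
    (\<integral>\<^sup>+s. indicator {0..1} s * ennreal ((cmod (f (w + Complex e (e * s))))\<^sup>2) \<partial>lborel)"
    by (rule power2_norm_segment_mean_le[OF hol w])
  also have "\<dots> \<le> (\<integral>\<^sup>+s. ennreal ((cmod (f (Complex (Re w + e) (Im w + e * s))))\<^sup>2) \<partial>lborel)"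
    unfolding pt by (intro nn_integral_mono) (auto simp: indicator_def)
  also have "\<dots> = ennreal (1 / e) * (\<integral>\<^sup>+y. ennreal ((cmod (f (Complex (Re w + e) y)))\<^sup>2) \<partial>lborel)"
    using nn_integral_real_affine[of "\<lambda>y. ennreal ((cmod (f (Complex (Re w + e) y)))\<^sup>2)" e "Im w"]
      measurable_line[OF f x] e
    by (simp add: mult.assoc[symmetric] ennreal_mult[symmetric])
  also have "\<dots> \<le> ennreal (1 / e) * hardy_energy f"
    by (intro mult_left_mono nn_line_energy_le x) auto
  also have "\<dots> = ennreal (enn2real (hardy_energy f) / e)"
    using e ennreal_hardy_energy[OF f] by (metis divide_nonneg_pos ennreal_mult'' enn2real_nonneg
        mult.commute mult_1 times_divide_eq_right zero_le_one)
  finally have "(cmod (segment_mean f e w))\<^sup>2 \<le> enn2real (hardy_energy f) / e"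
    using e by simp
  then show ?thesis by (rule real_le_rsqrt)
qed

text \<open>
  By Jensen and Tonelli, the energy of the mean on the imaginary axis is at most an average of
  energies of vertical translates of $f$ on the line over $e$, all of which are equal.
\<close>

lemma nn_integral_segment_mean_le:
  assumes f: "in_hardy f" and e: "e > 0"
  shows "(\<integral>\<^sup>+u. ennreal ((cmod (segment_mean f e (Complex 0 u)))\<^sup>2) \<partial>lborel) \<le> hardy_energy f"
proof -
  have hol: "f holomorphic_on right_half_plane"
    using f by (auto simp: in_hardy_def)
  define q where "q = (\<lambda>y. ennreal ((cmod (f (Complex e y)))\<^sup>2))"
  have [measurable]: "q \<in> borel_measurable borel"
    unfolding q_def using measurable_line[OF f e] by measurable
  have pt: "Complex 0 u + Complex e (e * s) = Complex e (u + e * s)" for u s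
    by (simp add: complex_eq_iff)
  have "(\<integral>\<^sup>+u. ennreal ((cmod (segment_mean f e (Complex 0 u)))\<^sup>2) \<partial>lborel) \<le>
      (\<integral>\<^sup>+u. (\<integral>\<^sup>+s. indicator {0..1} s * q (u + e * s) \<partial>lborel) \<partial>lborel)"
    using power2_norm_segment_mean_le[OF hol, of e "Complex 0 _"] e
    by (intro nn_integral_mono) (simp add: pt q_def)
  also have "\<dots> = (\<integral>\<^sup>+s. (\<integral>\<^sup>+u. indicator {0..1} s * q (u + e * s) \<partial>lborel) \<partial>lborel)"
    by (rule lborel_pair.Fubini') measurable
  also have "\<dots> = (\<integral>\<^sup>+s. indicator {0..1::real} s * (\<integral>\<^sup>+u. q u \<partial>lborel) \<partial>lborel)"
  proof -
    have "(\<integral>\<^sup>+u. q (u + t) \<partial>lborel) = (\<integral>\<^sup>+u. q u \<partial>lborel)" for t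
      using nn_integral_real_affine[of q 1 t] by (simp add: add.commute)
    then show ?thesis by (simp add: nn_integral_cmult)
  qed
  also have "\<dots> = (\<integral>\<^sup>+u. q u \<partial>lborel)"
    by (simp add: nn_integral_multc)
  also have "\<dots> \<le> hardy_energy f"
    unfolding q_def by (rule nn_line_energy_le[OF e])
  finally show ?thesis .
qed

lemma segment_mean_tendsto:
  assumes f: "f holomorphic_on right_half_plane" and w: "w \<in> right_half_plane"
    and e: "\<And>n. e n > 0" "e \<longlonglongrightarrow> 0"
  shows "(\<lambda>n. segment_mean f (e n) w) \<longlonglongrightarrow> f w"
proof (rule LIMSEQ_I)
  fix r :: real assume r: "r > 0"
  have "isCont f w"
    using f w by (rule isCont_half_plane)
  then obtain d where d: "d > 0" "\<And>z. dist z w < d \<Longrightarrow> dist (f z) (f w) < r / 2"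
    using r unfolding continuous_at_eps_delta by (metis half_gt_zero)
  obtain m where m: "\<And>n. n \<ge> m \<Longrightarrow> e n < d / 2"
    using order_tendstoD(2)[OF e(2), of "d / 2"] d(1) by (auto simp: eventually_sequentially)
  have "norm (segment_mean f (e n) w - f w) < r" if "n \<ge> m" for n
  proof -
    have wn: "Re w > - e n"
      using w e(1)[of n] by (simp add: right_half_plane_def)
    have close: "cmod (f (w + Complex (e n) (e n * s)) - f w) \<le> r / 2" if "s \<in> {0..1}" for s
    proof -
      have "cmod (Complex (e n) (e n * s)) \<le> \<bar>e n\<bar> + \<bar>e n * s\<bar>"
        using cmod_le[of "Complex (e n) (e n * s)"] by simp
      also have "\<bar>e n * s\<bar> \<le> e n"
        using that e(1)[of n] by (simp add: abs_mult mult_left_le)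
      finally have "cmod (Complex (e n) (e n * s)) < d"
        using m[OF \<open>n \<ge> m\<close>] e(1)[of n] by simp
      then show ?thesis
        using d(2)[of "w + Complex (e n) (e n * s)"] by (simp add: dist_norm)
    qed
    have int: "integrable lborel (\<lambda>s. indicator {0..1} s *\<^sub>R f (w + Complex (e n) (e n * s)))"
      by (intro borel_integrable_compact continuous_on_segment[OF f wn]) auto
    have int': "integrable lborel (\<lambda>s::real. indicator {0..1} s *\<^sub>R f w)"
      by (intro borel_integrable_compact continuous_intros) auto
    have "segment_mean f (e n) w - f w =
        (\<integral>s. indicator {0..1} s *\<^sub>R f (w + Complex (e n) (e n * s)) - indicator {0..1} s *\<^sub>R f w \<partial>lborel)"
      using int int' by (simp add: segment_mean_def)
    also have "cmod \<dots> \<le> (\<integral>s. (r / 2) * indicator {0..1::real} s \<partial>lborel)"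
    proof (intro order_trans[OF integral_norm_bound] integral_mono integrable_norm
          Bochner_Integration.integrable_diff int int')
      show "integrable lborel (\<lambda>s. (r / 2) * indicator {0..1::real} s)"
        by (intro integrable_mult_right integrable_real_indicator) auto
    qed (use close in \<open>auto simp: indicator_def\<close>)
    also have "\<dots> = r / 2" by simp
    finally show ?thesis using r by simp
  qed
  then show "\<exists>m. \<forall>n\<ge>m. norm (segment_mean f (e n) w - f w) < r" by blast
qed

section \<open>Inversion is an isometry\<close>

definition inversion :: "(complex \<Rightarrow> complex) \<Rightarrow> complex \<Rightarrow> complex" where
  "inversion f w = f (1 / w) / w"

lemma inverse_in_half_plane: "w \<in> right_half_plane \<Longrightarrow> 1 / w \<in> right_half_plane"
  by (auto simp: right_half_plane_def Re_divide complex_eq_iff sum_power2_gt_zero_iff)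

lemma inversion_holomorphic:
  assumes "f holomorphic_on right_half_plane"
  shows "inversion f holomorphic_on right_half_plane"
proof -
  have "f \<circ> (\<lambda>w. 1 / w) holomorphic_on right_half_plane"
    by (rule holomorphic_on_compose_gen[OF _ assms])
       (use inverse_in_half_plane in \<open>auto simp: right_half_plane_def intro!: holomorphic_intros\<close>)
  then have "(\<lambda>w. f (1 / w) / w) holomorphic_on right_half_plane"
    by (intro holomorphic_on_divide holomorphic_on_ident) (auto simp: o_def right_half_plane_def)
  then show ?thesis by (simp add: inversion_def[abs_def])
qed

text \<open>
  This is the inversion of $w \mapsto m(w)/(1+ew)$, where $m$ is the segment mean. The bounded
  mean makes it of size $O(1/|w + e|)$, so it lies in $H^2$ and dominated convergence computes its
  energy on the imaginary axis, where $u = -1/y$ compares it with the energy of the mean.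
\<close>

lemma regularized_inversion:
  assumes f: "in_hardy f" and e: "e > 0"
  defines "R \<equiv> \<lambda>w. segment_mean f e (1 / w) / (w + of_real e)"
  shows "R holomorphic_on right_half_plane" and "hardy_energy R \<le> hardy_energy f"
proof -
  have hol: "f holomorphic_on right_half_plane"
    using f by (simp add: in_hardy_def)
  have cont: "continuous_on {w. Re w > - e} (segment_mean f e)"
    using holomorphic_segment_mean[OF hol e] by (rule holomorphic_on_imp_continuous_on)
  have nz: "w + of_real e \<noteq> 0" if "Re w \<ge> 0" for w
  proof -
    have "Re (w + of_real e) > 0" using that e by simp
    then show ?thesis by (metis less_irrefl zero_complex.sel(1))
  qed
  have "segment_mean f e \<circ> (\<lambda>w. 1 / w) holomorphic_on right_half_plane"
  proof (rule holomorphic_on_compose_gen[OF _ holomorphic_segment_mean[OF hol e]])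
    show "(\<lambda>w. 1 / w) ` right_half_plane \<subseteq> {w. - e < Re w}"
      using inverse_in_half_plane e by (force simp: right_half_plane_def)
  qed (auto simp: right_half_plane_def intro!: holomorphic_intros)
  then show holR: "R holomorphic_on right_half_plane"
    unfolding R_def using nz
    by (intro holomorphic_on_divide holomorphic_intros) (auto simp: o_def right_half_plane_def)
  define K where "K = sqrt (enn2real (hardy_energy f) / e)"
  have decay: "cmod (R w) \<le> K / cmod (w + of_real e)" if "w \<in> right_half_plane" for w
  proof -
    have "Re (1 / w) > - e"
      using inverse_in_half_plane[OF that] e by (simp add: right_half_plane_def)
    from norm_segment_mean_le[OF f e this] show ?thesis
      unfolding R_def K_def norm_divide by (intro divide_right_mono) auto
  qed
  have R: "in_hardy R"
    using holR e decay by (rule in_hardy_of_decay)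
  \<comment> \<open>\<open>B\<close> is the squared modulus of \<open>R\<close> on the imaginary axis away from \<open>0\<close>, expressed by that of the mean at \<open>- 1 / y\<close>.\<close>
  define G where "G = (\<lambda>u. ennreal ((cmod (segment_mean f e (Complex 0 u)))\<^sup>2))"
  define B where "B = (\<lambda>y. G (- 1 / y) * ennreal (1 / (y\<^sup>2 + e\<^sup>2)))"
  have "continuous_on UNIV (\<lambda>u. segment_mean f e (Complex 0 u))"
    by (rule continuous_on_compose2[OF cont]) (use e in \<open>auto simp: Complex_eq intro!: continuous_intros\<close>)
  then have [measurable]: "(\<lambda>u. segment_mean f e (Complex 0 u)) \<in> borel_measurable borel"
    by (rule borel_measurable_continuous_onI)
  have [measurable]: "G \<in> borel_measurable borel"
    unfolding G_def by measurable
  define t where "t = (\<lambda>n. 1 / real (Suc n))"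
  have t: "t n > 0" "t \<longlonglongrightarrow> 0" for n
    unfolding t_def using LIMSEQ_inverse_real_of_nat by (auto simp: inverse_eq_divide)
  have nonzero: "AE y in lborel. y \<noteq> (0::real)"
    by (rule AE_lborel_singleton)
  have "(\<lambda>n. \<integral>\<^sup>+y. ennreal ((cmod (R (Complex (t n) y)))\<^sup>2) \<partial>lborel) \<longlonglongrightarrow> (\<integral>\<^sup>+y. B y \<partial>lborel)"
  proof (rule nn_integral_dominated_convergence)
    show "(\<lambda>y. ennreal ((cmod (R (Complex (t n) y)))\<^sup>2)) \<in> borel_measurable lborel" for n
      using measurable_line[OF R t(1)] by measurable
    show "B \<in> borel_measurable lborel"
      unfolding B_def by measurable
    show "AE y in lborel. ennreal ((cmod (R (Complex (t n) y)))\<^sup>2) \<le> ennreal (K\<^sup>2 / (e\<^sup>2 + y\<^sup>2))" for n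
    proof (intro AE_I2 ennreal_leI)
      fix y
      have "Complex (t n) y \<in> right_half_plane" "Re (Complex (t n) y) \<ge> 0"
        using t(1)[of n] by (auto simp: right_half_plane_def)
      with power2_cmod_le_of_decay[OF e _ decay] show "(cmod (R (Complex (t n) y)))\<^sup>2 \<le> K\<^sup>2 / (e\<^sup>2 + y\<^sup>2)"
        by fastforce
    qed
    show "(\<integral>\<^sup>+y. ennreal (K\<^sup>2 / (e\<^sup>2 + y\<^sup>2)) \<partial>lborel) < \<infinity>"
      using e by (rule nn_integral_inverse_quadratic_finite)
    show "AE y in lborel. (\<lambda>n. ennreal ((cmod (R (Complex (t n) y)))\<^sup>2)) \<longlonglongrightarrow> B y"
      using nonzero
    proof eventually_elim
      fix y :: real assume y: "y \<noteq> 0"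
      have to: "(\<lambda>n. Complex (t n) y) \<longlonglongrightarrow> Complex 0 y"
        unfolding Complex_eq using t(2) by (auto intro!: tendsto_eq_intros)
      have inv: "1 / Complex 0 y = Complex 0 (- 1 / y)"
        using y by (simp add: complex_eq_iff Re_divide Im_divide power2_eq_square)
      have "isCont (segment_mean f e) (Complex 0 (- 1 / y))"
        using cont e by (simp add: continuous_on_eq_continuous_at open_halfspace_Re_gt)
      moreover have "(\<lambda>n. 1 / Complex (t n) y) \<longlonglongrightarrow> Complex 0 (- 1 / y)"
        unfolding inv[symmetric] using y by (intro tendsto_intros to) (auto simp: complex_eq_iff)
      ultimately have "(\<lambda>n. segment_mean f e (1 / Complex (t n) y)) \<longlonglongrightarrow> segment_mean f e (Complex 0 (- 1 / y))"
        by (rule isCont_tendsto_compose)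
      then have "(\<lambda>n. R (Complex (t n) y)) \<longlonglongrightarrow> segment_mean f e (Complex 0 (- 1 / y)) / (Complex 0 y + of_real e)"
        unfolding R_def using nz[of "Complex 0 y"] by (intro tendsto_intros to) auto
      then have "(\<lambda>n. ennreal ((cmod (R (Complex (t n) y)))\<^sup>2)) \<longlonglongrightarrow>
          ennreal ((cmod (segment_mean f e (Complex 0 (- 1 / y)) / (Complex 0 y + of_real e)))\<^sup>2)"
        by (intro tendsto_ennrealI tendsto_intros)
      also have "ennreal ((cmod (segment_mean f e (Complex 0 (- 1 / y)) / (Complex 0 y + of_real e)))\<^sup>2) = B y"
      proof -
        have "(cmod (Complex 0 y + of_real e))\<^sup>2 = y\<^sup>2 + e\<^sup>2"
          by (simp add: cmod_power2)
        then show ?thesis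
          unfolding B_def G_def norm_divide power_divide
          by (subst ennreal_mult[symmetric]) simp_all
      qed
      finally show "(\<lambda>n. ennreal ((cmod (R (Complex (t n) y)))\<^sup>2)) \<longlonglongrightarrow> B y" .
    qed
  qed auto
  moreover have "(\<lambda>n. \<integral>\<^sup>+y. ennreal ((cmod (R (Complex (t n) y)))\<^sup>2) \<partial>lborel) \<longlonglongrightarrow> hardy_energy R"
  proof -
    have "filterlim t (at_right 0) sequentially"
      using t by (auto simp: filterlim_at order_less_imp_not_eq2)
    then have "(\<lambda>n. line_energy R (t n)) \<longlonglongrightarrow> enn2real (hardy_energy R)"
      by (rule filterlim_compose[OF line_energy_tendsto[OF R]])
    then have "(\<lambda>n. ennreal (line_energy R (t n))) \<longlonglongrightarrow> ennreal (enn2real (hardy_energy R))"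
      by (rule tendsto_ennrealI)
    then show ?thesis
      by (simp add: ennreal_line_energy[OF R t(1)] ennreal_hardy_energy[OF R])
  qed
  ultimately have "hardy_energy R = (\<integral>\<^sup>+y. B y \<partial>lborel)"
    by (rule LIMSEQ_unique[rotated])
  also have "\<dots> \<le> (\<integral>\<^sup>+y. G (- 1 / y) * ennreal (1 / y\<^sup>2) \<partial>lborel)"
  proof (rule nn_integral_mono_AE)
    show "AE y in lborel. B y \<le> G (- 1 / y) * ennreal (1 / y\<^sup>2)"
      using nonzero
    proof eventually_elim
      fix y :: real assume y: "y \<noteq> 0"
      have "0 < y\<^sup>2" "y\<^sup>2 \<le> y\<^sup>2 + e\<^sup>2" using y by auto
      then have "1 / (y\<^sup>2 + e\<^sup>2) \<le> 1 / y\<^sup>2"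
        by (intro divide_left_mono mult_pos_pos) linarith+
      then show "B y \<le> G (- 1 / y) * ennreal (1 / y\<^sup>2)"
        unfolding B_def by (intro mult_left_mono ennreal_leI) auto
    qed
  qed
  also have "\<dots> \<le> (\<integral>\<^sup>+u. G u \<partial>lborel)"
    by (rule nn_integral_reciprocal_le) measurable
  also have "\<dots> \<le> hardy_energy f"
    unfolding G_def by (rule nn_integral_segment_mean_le[OF f e])
  finally show "hardy_energy R \<le> hardy_energy f" .
qed

text \<open>
  The regularized inversions converge pointwise to \<open>inversion f\<close>, and their energies are bounded by
  that of $f$; Fatou's lemma on each line passes to the limit.
\<close>

lemma hardy_energy_inversion_le:
  assumes f: "in_hardy f"
  shows "hardy_energy (inversion f) \<le> hardy_energy f"
proof (subst hardy_energy_def, rule SUP_least)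
  fix x :: real assume "x \<in> {0<..}"
  then have x: "x > 0" by simp
  have hol: "f holomorphic_on right_half_plane"
    using f by (simp add: in_hardy_def)
  define e where "e = (\<lambda>n. 1 / real (Suc n))"
  have e: "e n > 0" "e \<longlonglongrightarrow> 0" for n
    unfolding e_def using LIMSEQ_inverse_real_of_nat by (auto simp: inverse_eq_divide)
  define R where "R = (\<lambda>n w. segment_mean f (e n) (1 / w) / (w + of_real (e n)))"
  have R: "R n holomorphic_on right_half_plane" "hardy_energy (R n) \<le> hardy_energy f" for n
    unfolding R_def by (rule regularized_inversion[OF f e(1)])+
  show "(\<integral>\<^sup>+y. ennreal ((cmod (inversion f (Complex x y)))\<^sup>2) \<partial>lborel) \<le> hardy_energy f"
  proof (rule nn_integral_le_of_tendsto)
    show "(\<lambda>y. ennreal ((cmod (R n (Complex x y)))\<^sup>2)) \<in> borel_measurable lborel" for n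
      using line_measurable[OF R(1) x] by simp
    show "(\<integral>\<^sup>+y. ennreal ((cmod (R n (Complex x y)))\<^sup>2) \<partial>lborel) \<le> hardy_energy f" for n
      using nn_line_energy_le[OF x, of "R n"] R(2)[of n] by (rule order_trans)
    fix y
    have w: "Complex x y \<in> right_half_plane" "Complex x y \<noteq> 0"
      using x by (auto simp: right_half_plane_def complex_eq_iff)
    have "(\<lambda>n. R n (Complex x y)) \<longlonglongrightarrow> f (1 / Complex x y) / (Complex x y + of_real 0)"
      unfolding R_def
      by (intro tendsto_intros segment_mean_tendsto hol inverse_in_half_plane e) (use w in auto)
    then show "(\<lambda>n. ennreal ((cmod (R n (Complex x y)))\<^sup>2)) \<longlonglongrightarrow> ennreal ((cmod (inversion f (Complex x y)))\<^sup>2)"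
      unfolding inversion_def by (intro tendsto_ennrealI tendsto_intros) simp
  qed
qed

lemma in_hardy_inversion: "in_hardy f \<Longrightarrow> in_hardy (inversion f)"
  using inversion_holomorphic hardy_energy_inversion_le by (auto simp: in_hardy_def intro: le_less_trans)

lemma inversion_inversion: "w \<noteq> 0 \<Longrightarrow> inversion (inversion f) w = f w"
  by (simp add: inversion_def)

text \<open>
  Inversion is an involution that does not increase the energy.
\<close>

lemma hardy_energy_inversion:
  assumes "in_hardy f"
  shows "hardy_energy (inversion f) = hardy_energy f"
proof (rule antisym[OF hardy_energy_inversion_le[OF assms]])
  have "hardy_energy f = hardy_energy (inversion (inversion f))"
    by (rule hardy_energy_cong[symmetric], rule inversion_inversion) (auto simp: right_half_plane_def)
  also have "\<dots> \<le> hardy_energy (inversion f)"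
    by (intro hardy_energy_inversion_le in_hardy_inversion assms)
  finally show "hardy_energy f \<le> hardy_energy (inversion f)" .
qed

section \<open>Conjugations\<close>

definition to_hardy :: "(complex \<Rightarrow> complex) \<Rightarrow> hardy2" where
  "to_hardy f = Abs_hardy2 (\<lambda>w. if w \<in> right_half_plane then f w else 0)"

lemma hardy_fun_to_hardy:
  assumes "in_hardy f" "w \<in> right_half_plane"
  shows "hardy_fun (to_hardy f) w = f w"
proof -
  let ?g = "\<lambda>w. if w \<in> right_half_plane then f w else 0"
  have "?g holomorphic_on right_half_plane"
    by (rule holomorphic_transform[of f]) (use assms in \<open>auto simp: in_hardy_def\<close>)
  moreover have "hardy_energy ?g = hardy_energy f"
    by (rule hardy_energy_cong) auto
  ultimately show ?thesis
    unfolding to_hardy_def using assms by (subst Abs_hardy2_inverse) (auto simp: in_hardy_def)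
qed

lemma hardy_norm_to_hardy:
  assumes "in_hardy f" "hardy_energy f = hardy_energy (hardy_fun g)"
  shows "hardy_norm (to_hardy f) = hardy_norm g"
proof -
  have "hardy_energy (hardy_fun (to_hardy f)) = hardy_energy f"
    by (rule hardy_energy_cong) (rule hardy_fun_to_hardy[OF assms(1)])
  then show ?thesis by (simp add: hardy_norm_def assms(2))
qed

lemma hardy_norm_scaleC: "hardy_norm (scaleC c f) = cmod c * hardy_norm f"
  using in_hardy_hardy_fun[of f]
  by (simp add: hardy_norm_def scaleC.rep_eq hardy_energy_scale in_hardy_def enn2real_mult real_sqrt_mult)

text \<open>
  By polarization, an antilinear map that preserves the norm exchanges the arguments of the inner
  product.
\<close>

lemma conjugation_of_isometry:
  assumes add: "\<And>f g. C (f + g) = C f + C g"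
    and scale: "\<And>c f. C (scaleC c f) = scaleC (cnj c) (C f)"
    and norm: "\<And>f. hardy_norm (C f) = hardy_norm f"
    and inv: "\<And>f. C (C f) = f"
  shows "conjugation C"
proof -
  have "hardy_inner (C f) (C g) = hardy_inner g f" for f g
  proof -
    have *: "hardy_norm (C f + scaleC (\<i> ^ k) (C g)) = hardy_norm (g + scaleC (\<i> ^ k) f)" for k
    proof -
      have "scaleC (\<i> ^ k) (C g) = C (scaleC (cnj (\<i> ^ k)) g)"
        by (simp add: scale)
      then have "hardy_norm (C f + scaleC (\<i> ^ k) (C g)) = hardy_norm (f + scaleC (cnj (\<i> ^ k)) g)"
        by (simp only: add[symmetric] norm)
      also have "\<dots> = hardy_norm (scaleC (\<i> ^ k) (f + scaleC (cnj (\<i> ^ k)) g))"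
        by (simp add: hardy_norm_scaleC norm_power)
      also have "scaleC (\<i> ^ k) (f + scaleC (cnj (\<i> ^ k)) g) = g + scaleC (\<i> ^ k) f"
      proof -
        have "\<i> ^ k * cnj (\<i> ^ k) = 1"
          by (simp add: complex_norm_square[symmetric] norm_power flip: power_mult_distrib)
        then show ?thesis
          by (simp add: hardy2.scale_right_distrib add.commute)
      qed
      finally show ?thesis .
    qed
    show ?thesis by (simp only: hardy_inner_def *)
  qed
  then show ?thesis
    unfolding conjugation_def using add scale inv by (auto simp: fun_eq_iff)
qed

lemma in_hardy_cnj:
  assumes "in_hardy f"
  shows "in_hardy (\<lambda>w. cnj (f (cnj w)))" "hardy_energy (\<lambda>w. cnj (f (cnj w))) = hardy_energy f"
proof -
  have "(\<integral>\<^sup>+y. ennreal ((cmod (f (cnj (Complex x y))))\<^sup>2) \<partial>lborel) =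
      (\<integral>\<^sup>+y. ennreal ((cmod (f (Complex x y)))\<^sup>2) \<partial>lborel)" if "x > 0" for x
    using nn_integral_real_affine[of "\<lambda>y. ennreal ((cmod (f (Complex x y)))\<^sup>2)" "-1" 0]
      measurable_line[OF assms that] by (simp add: complex_cnj)
  then show *: "hardy_energy (\<lambda>w. cnj (f (cnj w))) = hardy_energy f"
    unfolding hardy_energy_def by (intro SUP_cong) auto
  show "in_hardy (\<lambda>w. cnj (f (cnj w)))"
    using assms * holomorphic_on_cnj_half_plane by (simp add: in_hardy_def)
qed

lemma in_hardy_vertical_shift:
  assumes f: "in_hardy f" and p: "Re p = 0"
  shows "in_hardy (\<lambda>w. f (w + p))" "hardy_energy (\<lambda>w. f (w + p)) = hardy_energy f"
proof -
  have "(\<integral>\<^sup>+y. ennreal ((cmod (f (Complex x y + p)))\<^sup>2) \<partial>lborel) =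
      (\<integral>\<^sup>+y. ennreal ((cmod (f (Complex x y)))\<^sup>2) \<partial>lborel)" if "x > 0" for x
  proof -
    have "Complex x y + p = Complex x (Im p + y)" for y
      using p by (simp add: complex_eq_iff)
    then show ?thesis
      using nn_integral_real_affine[of "\<lambda>y. ennreal ((cmod (f (Complex x y)))\<^sup>2)" 1 "Im p"]
        measurable_line[OF f that] by simp
  qed
  then show *: "hardy_energy (\<lambda>w. f (w + p)) = hardy_energy f"
    unfolding hardy_energy_def by (intro SUP_cong) auto
  have "f \<circ> (\<lambda>w. w + p) holomorphic_on right_half_plane"
    by (rule holomorphic_on_compose_gen[where t = right_half_plane])
       (use f p in \<open>auto simp: in_hardy_def right_half_plane_def intro!: holomorphic_intros\<close>)
  then show "in_hardy (\<lambda>w. f (w + p))"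
    using f * by (simp add: in_hardy_def o_def)
qed

definition reflection :: "hardy2 \<Rightarrow> hardy2" where
  "reflection f = to_hardy (\<lambda>w. cnj (hardy_fun f (cnj w)))"

lemma hardy_fun_reflection:
  "w \<in> right_half_plane \<Longrightarrow> hardy_fun (reflection f) w = cnj (hardy_fun f (cnj w))"
  unfolding reflection_def by (simp add: hardy_fun_to_hardy in_hardy_cnj)

lemma conjugation_reflection: "conjugation reflection"
proof (rule conjugation_of_isometry)
  fix f g c
  have cnj: "cnj w \<in> right_half_plane" if "w \<in> right_half_plane" for w
    using that by (simp add: right_half_plane_def)
  show "reflection (f + g) = reflection f + reflection g"
    by (rule hardy2_eqI) (simp add: hardy_fun_reflection plus_hardy2.rep_eq)
  show "reflection (scaleC c f) = scaleC (cnj c) (reflection f)"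
    by (rule hardy2_eqI) (simp add: hardy_fun_reflection scaleC.rep_eq)
  show "hardy_norm (reflection f) = hardy_norm f"
    unfolding reflection_def by (intro hardy_norm_to_hardy in_hardy_cnj in_hardy_hardy_fun)
  show "reflection (reflection f) = f"
    by (rule hardy2_eqI) (simp add: hardy_fun_reflection cnj)
qed

text \<open>
  For $p$ on the imaginary axis, $w \mapsto p + 1/\overline{(w-p)}$ is the reflection in the unit
  circle around $p$. The factor $1/(w-p)$ makes composition with it isometric.
\<close>

definition circle_reflection :: "complex \<Rightarrow> hardy2 \<Rightarrow> hardy2" where
  "circle_reflection p f = to_hardy (\<lambda>w. cnj (hardy_fun f (1 / cnj (w - p) + p)) / (w - p))"

context
  fixes p :: complex assumes p: "Re p = 0"
begin

text \<open>
  The map is a composition of a vertical translation, complex conjugation, inversion and the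
  opposite translation, all of which preserve the energy.
\<close>

lemma circle_reflection_properties:
  assumes "in_hardy f"
  shows "in_hardy (\<lambda>w. cnj (f (1 / cnj (w - p) + p)) / (w - p))"
    "hardy_energy (\<lambda>w. cnj (f (1 / cnj (w - p) + p)) / (w - p)) = hardy_energy f"
proof -
  note 1 = in_hardy_vertical_shift[OF assms p]
  note 2 = in_hardy_cnj[OF 1(1)]
  note 3 = in_hardy_inversion[OF 2(1)] hardy_energy_inversion[OF 2(1)]
  have "Re (- p) = 0" using p by simp
  note 4 = in_hardy_vertical_shift[OF 3(1) this]
  show "in_hardy (\<lambda>w. cnj (f (1 / cnj (w - p) + p)) / (w - p))"
    "hardy_energy (\<lambda>w. cnj (f (1 / cnj (w - p) + p)) / (w - p)) = hardy_energy f"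
    using 1 2 3 4 by (simp_all add: inversion_def)
qed

lemma hardy_fun_circle_reflection:
  "w \<in> right_half_plane \<Longrightarrow>
    hardy_fun (circle_reflection p f) w = cnj (hardy_fun f (1 / cnj (w - p) + p)) / (w - p)"
  unfolding circle_reflection_def
  by (rule hardy_fun_to_hardy[OF circle_reflection_properties(1)[OF in_hardy_hardy_fun]])

lemma reflected_point_in_half_plane:
  assumes "w \<in> right_half_plane"
  shows "1 / cnj (w - p) + p \<in> right_half_plane"
proof -
  have "cnj (w - p) \<in> right_half_plane"
    using assms p by (simp add: right_half_plane_def)
  from inverse_in_half_plane[OF this] show ?thesis
    using p by (simp add: right_half_plane_def)
qed

lemma conjugation_circle_reflection: "conjugation (circle_reflection p)"
proof (rule conjugation_of_isometry)
  fix f g c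
  show "circle_reflection p (f + g) = circle_reflection p f + circle_reflection p g"
    by (rule hardy2_eqI) (simp add: hardy_fun_circle_reflection plus_hardy2.rep_eq add_divide_distrib)
  show "circle_reflection p (scaleC c f) = scaleC (cnj c) (circle_reflection p f)"
    by (rule hardy2_eqI) (simp add: hardy_fun_circle_reflection scaleC.rep_eq)
  show "hardy_norm (circle_reflection p f) = hardy_norm f"
    unfolding circle_reflection_def
    by (intro hardy_norm_to_hardy circle_reflection_properties in_hardy_hardy_fun)
  show "circle_reflection p (circle_reflection p f) = f"
  proof (rule hardy2_eqI)
    fix w assume w: "w \<in> right_half_plane"
    then have "w - p \<noteq> 0" using p by (auto simp: right_half_plane_def)
    then show "hardy_fun (circle_reflection p (circle_reflection p f)) w = hardy_fun f w"
      unfolding hardy_fun_circle_reflection[OF w]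
        hardy_fun_circle_reflection[OF reflected_point_in_half_plane[OF w]] by simp
  qed
qed

end

section \<open>Affine composition operators\<close>

text \<open>
  For $v = \bar z$ this is, up to a constant, the reproducing kernel of $H^2$ at $z$.
\<close>

lemma in_hardy_kernel:
  assumes "v \<in> right_half_plane"
  shows "in_hardy (\<lambda>w. 1 / (w + v))"
proof -
  have v: "Re v > 0" using assms by (simp add: right_half_plane_def)
  have nz: "w + v \<noteq> 0" if "Re w > 0" for w
  proof -
    have "Re (w + v) > 0" using that v by simp
    then show ?thesis by (metis less_irrefl zero_complex.sel(1))
  qed
  have "in_hardy (\<lambda>w. 1 / (w + of_real (Re v)))"
  proof (rule in_hardy_of_decay[where c = "Re v" and K = 1])
    have "w + of_real (Re v) \<noteq> 0" if "Re w > 0" for w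
      using that v by (auto simp: complex_eq_iff)
    then show "(\<lambda>w. 1 / (w + of_real (Re v))) holomorphic_on right_half_plane"
      by (auto simp: right_half_plane_def intro!: holomorphic_intros)
  qed (use v in \<open>auto simp: norm_divide\<close>)
  from in_hardy_vertical_shift(1)[OF this, of "\<i> * of_real (Im v)"] show ?thesis
    by (simp add: add.assoc add.commute[of "\<i> * _"] flip: complex_eq)
qed

abbreviation affine_composition :: "real \<Rightarrow> complex \<Rightarrow> hardy2 \<Rightarrow> hardy2" where
  "affine_composition a b \<equiv> composition_operator (\<lambda>w. complex_of_real a * w + b)"

text \<open>
  The affine map contracts towards its fixed point $d/(1-c)$ in the half-plane, so invariance makes
  $f(w)$ equal to the value of $f$ there. A nonzero constant has infinite energy.
\<close>

lemma hardy2_invariant_imp_zero: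
  assumes c: "0 < c" "c < 1" and d: "Re d > 0"
    and inv: "\<And>w. w \<in> right_half_plane \<Longrightarrow> hardy_fun f (of_real c * w + d) = hardy_fun f w"
  shows "f = 0"
proof -
  define w\<^sub>0 where "w\<^sub>0 = d / of_real (1 - c)"
  have fixed: "of_real c * w\<^sub>0 + d = w\<^sub>0"
    using c by (simp add: w\<^sub>0_def field_simps)
  have w\<^sub>0: "w\<^sub>0 \<in> right_half_plane"
    using c d by (simp add: w\<^sub>0_def right_half_plane_def Re_divide_of_real)
  have const: "hardy_fun f w = hardy_fun f w\<^sub>0" if w: "w \<in> right_half_plane" for w
  proof -
    define z where "z = (\<lambda>n. w\<^sub>0 + of_real (c ^ n) * (w - w\<^sub>0))"
    have step: "z (Suc n) = of_real c * z n + d" for n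
    proof -
      have "of_real c * z n + d = (of_real c * w\<^sub>0 + d) + of_real (c ^ Suc n) * (w - w\<^sub>0)"
        by (simp add: z_def algebra_simps)
      then show ?thesis unfolding fixed by (simp add: z_def)
    qed
    have z: "z n \<in> right_half_plane \<and> hardy_fun f (z n) = hardy_fun f w" for n
    proof (induction n)
      case 0
      then show ?case using w by (simp add: z_def)
    next
      case (Suc n)
      then show ?case
        unfolding step using affine_maps_half_plane[of c d "z n"] inv c d by simp
    qed
    have "isCont (hardy_fun f) w\<^sub>0"
      using in_hardy_hardy_fun[of f] w\<^sub>0 by (intro isCont_half_plane) (auto simp: in_hardy_def)
    moreover have "(\<lambda>n. of_real (c ^ n) :: complex) \<longlonglongrightarrow> of_real 0"
      using c by (intro tendsto_of_real LIMSEQ_power_zero) simp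
    then have "z \<longlonglongrightarrow> w\<^sub>0 + of_real 0 * (w - w\<^sub>0)"
      unfolding z_def by (intro tendsto_add tendsto_mult tendsto_const)
    ultimately have "(\<lambda>n. hardy_fun f (z n)) \<longlonglongrightarrow> hardy_fun f w\<^sub>0"
      by (intro isCont_tendsto_compose[where g = "hardy_fun f"]) auto
    then show ?thesis using z by (simp add: LIMSEQ_const_iff)
  qed
  have "hardy_fun f w\<^sub>0 = 0"
  proof (rule ccontr)
    assume nz: "hardy_fun f w\<^sub>0 \<noteq> 0"
    have "(\<integral>\<^sup>+y. ennreal ((cmod (hardy_fun f (Complex 1 y)))\<^sup>2) \<partial>lborel) = \<infinity>"
      using nz by (simp add: const right_half_plane_def ennreal_mult_eq_top_iff)
    then show False
      using nn_line_energy_le[of 1 "hardy_fun f"] in_hardy_hardy_fun[of f] by (simp add: in_hardy_def top_unique)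
  qed
  with const show ?thesis
    by (intro hardy2_eqI) (simp add: zero_hardy2.rep_eq)
qed

context
  fixes a :: real and b :: complex
  assumes a: "a > 0" and b: "Re b \<ge> 0"
begin

lemma hardy_fun_affine_composition:
  "w \<in> right_half_plane \<Longrightarrow> hardy_fun ((affine_composition a b) f) w = hardy_fun f (of_real a * w + b)"
  by (simp add: hardy_fun_composition_affine[OF a b])

lemma hardy_fun_adjoint_affine_composition:
  assumes "w \<in> right_half_plane"
  shows "hardy_fun (hardy_adjoint (affine_composition a b) f) w = hardy_fun f ((w + cnj b) / of_real a) / of_real a"
proof -
  have "1 / a > 0" "Re (cnj b / of_real a) \<ge> 0" using a b by auto
  note hf = hardy_fun_composition_affine[OF this]
  have "of_real (1 / a) * w + cnj b / of_real a = (w + cnj b) / of_real a"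
    by (simp add: add_divide_distrib)
  with assms show ?thesis
    unfolding hardy_adjoint_composition_affine[OF a b] scaleC.rep_eq hf by simp
qed

lemma adjoint_point_in_half_plane:
  "w \<in> right_half_plane \<Longrightarrow> (w + cnj b) / of_real a \<in> right_half_plane"
  using a b by (simp add: right_half_plane_def add_pos_nonneg)

text \<open>
  The two products translate the argument by $2\mathrm{Re}(b)/a$ and by $2\mathrm{Re}(b)$. One
  injective function in $H^2$, the kernel $1/(w+1)$, tells different translations apart.
\<close>

lemma normal_affine_composition_iff: "normal_operator (affine_composition a b) \<longleftrightarrow> a = 1 \<or> Re b = 0"
proof -
  have bounded: "bounded_operator (affine_composition a b)"
    by (rule bounded_operator_composition_affine[OF a b])
  have TA: "hardy_fun ((affine_composition a b) (hardy_adjoint (affine_composition a b) f)) w = hardy_fun f (w + of_real (2 * Re b / a)) / of_real a"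
    if w: "w \<in> right_half_plane" for f w
  proof -
    have "(of_real a * w + b + cnj b) / of_real a = w + of_real (2 * Re b / a)"
      using a by (simp add: complex_eq_iff field_simps)
    then show ?thesis
      using hardy_fun_adjoint_affine_composition affine_maps_half_plane[OF a b w] by (simp add: hardy_fun_affine_composition w)
  qed
  have AT: "hardy_fun (hardy_adjoint (affine_composition a b) ((affine_composition a b) f)) w = hardy_fun f (w + of_real (2 * Re b)) / of_real a"
    if w: "w \<in> right_half_plane" for f w
  proof -
    have "of_real a * ((w + cnj b) / of_real a) + b = w + of_real (2 * Re b)"
      using a by (simp add: complex_eq_iff field_simps)
    then show ?thesis
      using hardy_fun_affine_composition[OF adjoint_point_in_half_plane[OF w], of f] by (simp add: hardy_fun_adjoint_affine_composition w)
  qed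
  show ?thesis
  proof
    assume "normal_operator (affine_composition a b)"
    then have eq: "(affine_composition a b) (hardy_adjoint (affine_composition a b) f) = hardy_adjoint (affine_composition a b) ((affine_composition a b) f)" for f
      by (metis normal_operator_def comp_apply)
    define k where "k = to_hardy (\<lambda>w. 1 / (w + 1))"
    have k: "hardy_fun k w = 1 / (w + 1)" if "w \<in> right_half_plane" for w
      unfolding k_def by (rule hardy_fun_to_hardy[OF in_hardy_kernel that]) (simp add: right_half_plane_def)
    have mem: "1 \<in> right_half_plane" "1 + of_real (2 * Re b / a) \<in> right_half_plane"
        "1 + of_real (2 * Re b) \<in> right_half_plane"
      using a b by (auto simp: right_half_plane_def add_pos_nonneg)
    have "hardy_fun k (1 + of_real (2 * Re b / a)) = hardy_fun k (1 + of_real (2 * Re b))"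
      using TA[OF mem(1), of k] AT[OF mem(1), of k] eq[of k] a by simp
    then have "1 + complex_of_real (2 * Re b / a) + 1 = 1 + of_real (2 * Re b) + 1"
      unfolding k[OF mem(2)] k[OF mem(3)] by simp
    then have "2 * Re b / a = 2 * Re b"
      by (simp only: add_right_cancel add_left_cancel of_real_eq_iff)
    then show "a = 1 \<or> Re b = 0" using a by (auto simp: field_simps)
  next
    assume "a = 1 \<or> Re b = 0"
    then have "2 * Re b / a = 2 * Re b" by auto
    then have "(affine_composition a b) (hardy_adjoint (affine_composition a b) f) = hardy_adjoint (affine_composition a b) ((affine_composition a b) f)" for f
      by (intro hardy2_eqI) (simp only: TA AT)
    then show "normal_operator (affine_composition a b)"
      unfolding normal_operator_def using bounded by (auto simp: fun_eq_iff)
  qed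
qed

lemma complex_symmetric_affine_composition:
  assumes "a = 1 \<or> Re b = 0"
  shows "complex_symmetric (affine_composition a b)"
proof -
  have "\<exists>C. conjugation C \<and> (\<forall>f. C ((affine_composition a b) f) = hardy_adjoint (affine_composition a b) (C f))"
  proof (cases "a = 1")
    case True
    have "reflection ((affine_composition a b) f) = hardy_adjoint (affine_composition a b) (reflection f)" for f
    proof (rule hardy2_eqI)
      fix w assume w: "w \<in> right_half_plane"
      have "w + cnj b \<in> right_half_plane" "cnj w \<in> right_half_plane"
        using adjoint_point_in_half_plane[OF w] True w by (auto simp: right_half_plane_def)
      then show "hardy_fun (reflection ((affine_composition a b) f)) w = hardy_fun (hardy_adjoint (affine_composition a b) (reflection f)) w"
        using hardy_fun_affine_composition[of "cnj w" f] hardy_fun_adjoint_affine_composition[of w "reflection f"] True w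
        by (simp add: hardy_fun_reflection)
    qed
    with conjugation_reflection show ?thesis by blast
  next
    case False
    with assms have b0: "Re b = 0" by simp
    \<comment> \<open>The fixed point of the symbol, about which the operator is a dilation.\<close>
    define p where "p = b / (1 - of_real a)"
    have a1: "1 - complex_of_real a \<noteq> 0" using False by (metis eq_iff_diff_eq_0 of_real_1 of_real_eq_iff)
    have p: "Re p = 0"
    proof -
      have "p = b / of_real (1 - a)" by (simp add: p_def)
      then show ?thesis using b0 by (simp only: Re_divide_of_real)
    qed
    have cb: "cnj b = - b" using b0 by (simp add: complex_eq_iff)
    have fixed: "of_real a * p + b = p"
      using a1 by (simp add: p_def field_simps)
    have "circle_reflection p ((affine_composition a b) f) = hardy_adjoint (affine_composition a b) (circle_reflection p f)" for f
    proof (rule hardy2_eqI)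
      fix w assume w: "w \<in> right_half_plane"
      let ?v = "(w + cnj b) / of_real a"
      have v: "?v - p = (w - p) / of_real a"
      proof -
        have "?v - p = (w - (of_real a * p + b)) / of_real a"
          using a by (simp add: cb field_simps)
        then show ?thesis by (simp only: fixed)
      qed
      have pt: "of_real a * (1 / cnj (w - p) + p) + b = 1 / cnj (?v - p) + p"
      proof -
        have "of_real a * (1 / cnj (w - p) + p) + b = of_real a / cnj (w - p) + (of_real a * p + b)"
          by (simp add: algebra_simps)
        also have "\<dots> = 1 / cnj (?v - p) + p"
          using a unfolding v fixed by simp
        finally show ?thesis .
      qed
      have "hardy_fun (circle_reflection p ((affine_composition a b) f)) w = cnj (hardy_fun f (1 / cnj (?v - p) + p)) / (w - p)"
        unfolding hardy_fun_circle_reflection[OF p w]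
          hardy_fun_affine_composition[OF reflected_point_in_half_plane[OF p w]] pt ..
      also have "\<dots> = cnj (hardy_fun f (1 / cnj (?v - p) + p)) / (?v - p) / of_real a"
        using a unfolding v by simp
      also have "\<dots> = hardy_fun (hardy_adjoint (affine_composition a b) (circle_reflection p f)) w"
        unfolding hardy_fun_adjoint_affine_composition[OF w]
          hardy_fun_circle_reflection[OF p adjoint_point_in_half_plane[OF w]] ..
      finally show "hardy_fun (circle_reflection p ((affine_composition a b) f)) w = \<dots>" .
    qed
    with conjugation_circle_reflection[OF p] show ?thesis by blast
  qed
  then show ?thesis
    unfolding complex_symmetric_def
    using bounded_operator_composition_affine[OF a b] by (auto simp: fun_eq_iff)
qed

lemma not_complex_symmetric_affine_composition:
  assumes "a \<noteq> 1" and b': "Re b > 0"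
  shows "\<not> complex_symmetric (affine_composition a b)"
proof
  assume "complex_symmetric (affine_composition a b)"
  then obtain C where C: "conjugation C"
    and sym: "\<And>f. C (affine_composition a b f) = hardy_adjoint (affine_composition a b) (C f)"
    unfolding complex_symmetric_def by (metis comp_apply)
  have CC: "C (C f) = f" for f
    using C unfolding conjugation_def by (metis comp_apply id_apply)
  have C_scale: "C (scaleC c f) = scaleC (cnj c) (C f)" for c f
    using C by (simp add: conjugation_def)
  have "C 0 = 0"
    using C_scale[of 0 0] by simp
  \<comment> \<open>The conjugate of \<open>u\<close> is the fixed point of the contraction: of \<open>w \<mapsto> a w + b\<close> if \<open>a < 1\<close>, and of \<open>w \<mapsto> (w + cnj b) / a\<close> if \<open>a > 1\<close>.\<close>
  define u where "u = (if a < 1 then cnj b / of_real (1 - a) else b / of_real (a - 1))"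
  have u: "u \<in> right_half_plane"
    using assms by (auto simp: u_def right_half_plane_def Re_divide_of_real)
  define k where "k = to_hardy (\<lambda>w. 1 / (w + u))"
  have k: "hardy_fun k w = 1 / (w + u)" if "w \<in> right_half_plane" for w
    unfolding k_def by (rule hardy_fun_to_hardy[OF in_hardy_kernel[OF u] that])
  \<comment> \<open>Depending on \<open>a\<close>, \<open>k\<close> is an eigenvector of the adjoint or of the operator itself; \<open>C\<close> carries it to an eigenvector of the other one.\<close>
  have "C k = 0"
  proof (cases "a < 1")
    case True
    have fixed: "cnj b + of_real a * u = u"
      using True by (simp add: u_def field_simps)
    have "hardy_adjoint (affine_composition a b) k = k"
    proof (rule hardy2_eqI)
      fix w assume w: "w \<in> right_half_plane"
      have "of_real a * ((w + cnj b) / of_real a + u) = w + (cnj b + of_real a * u)"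
        using a by (simp add: field_simps)
      then show "hardy_fun (hardy_adjoint (affine_composition a b) k) w = hardy_fun k w"
        unfolding hardy_fun_adjoint_affine_composition[OF w] k[OF adjoint_point_in_half_plane[OF w]] k[OF w] fixed
        by (simp add: mult.commute)
    qed
    then have eig: "affine_composition a b (C k) = C k"
      using sym[of "C k"] by (metis CC)
    show ?thesis
    proof (rule hardy2_invariant_imp_zero[OF a True b'])
      fix w assume "w \<in> right_half_plane"
      from hardy_fun_affine_composition[OF this, of "C k"]
      show "hardy_fun (C k) (of_real a * w + b) = hardy_fun (C k) w"
        unfolding eig by simp
    qed
  next
    case False
    then have a1: "a > 1" using assms by simp
    have fixed: "b + u = of_real a * u"
      using a1 by (simp add: u_def field_simps)
    have "affine_composition a b k = scaleC (of_real (1 / a)) k"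
    proof (rule hardy2_eqI)
      fix w assume w: "w \<in> right_half_plane"
      have "of_real a * w + b + u = of_real a * (w + u)"
        using fixed by (simp add: algebra_simps)
      then show "hardy_fun (affine_composition a b k) w = hardy_fun (scaleC (of_real (1 / a)) k) w"
        unfolding hardy_fun_affine_composition[OF w] scaleC.rep_eq
          k[OF affine_maps_half_plane[OF a b w]] k[OF w] by simp
    qed
    with sym[of k] have eig: "hardy_adjoint (affine_composition a b) (C k) = scaleC (of_real (1 / a)) (C k)"
      by (simp add: C_scale)
    show ?thesis
    proof (rule hardy2_invariant_imp_zero[of "1 / a" "cnj b / of_real a"])
      fix w assume "w \<in> right_half_plane"
      from hardy_fun_adjoint_affine_composition[OF this, of "C k"]
      show "hardy_fun (C k) (of_real (1 / a) * w + cnj b / of_real a) = hardy_fun (C k) w"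
        unfolding eig scaleC.rep_eq using a by (simp add: add_divide_distrib)
    qed (use a1 b' in \<open>auto simp: Re_divide_of_real\<close>)
  qed
  then have "k = 0"
    using CC[of k] \<open>C 0 = 0\<close> by simp
  moreover have "hardy_fun k u \<noteq> 0"
    using k[OF u] u by (auto simp: right_half_plane_def)
  ultimately show False
    by (simp add: zero_hardy2.rep_eq)
qed

end

theorem theorem6:
  fixes a :: real and b :: complex
  assumes "a > 0" and "Re b \<ge> 0"
  defines "\<phi> \<equiv> (\<lambda>w. complex_of_real a * w + b)"
  shows "(complex_symmetric (composition_operator \<phi>) \<longleftrightarrow> a = 1 \<or> Re b = 0)
    \<and> (complex_symmetric (composition_operator \<phi>) \<longleftrightarrow> normal_operator (composition_operator \<phi>))"
proof -
  have "complex_symmetric (composition_operator \<phi>) \<longleftrightarrow> a = 1 \<or> Re b = 0"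
    using complex_symmetric_affine_composition[OF assms(1,2)]
      not_complex_symmetric_affine_composition[OF assms(1,2)] assms(2)
    unfolding \<phi>_def by argo
  then show ?thesis
    using normal_affine_composition_iff[OF assms(1,2)] unfolding \<phi>_def by blast
qed

end
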